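(* Let $\mathcal{H}$ be a real Hilbert space with $\dim\mathcal{H}<+\infty$ and let $q\in\mathcal{H}$. Let $g\colon\mathcal{H}\to\left]-\infty,+\infty\right]$ be proper, lower semicontinuous and $\alpha_A$-convex, and let $B\colon\mathcal{H}\to\mathcal{H}$ be $\alpha_B$-monotone and locally Lipschitz continuous, where $\alpha_A,\alpha_B\in\mathbb{R}$. Let $\theta,\sigma_A,\sigma_B>0$ be such that $\theta\alpha_A+\sigma_A>0$ and $\theta\alpha_B+\sigma_B>0$. Choose $x_0,x_1\in\mathcal{H}$, $\gamma_0,\overline{\gamma}>0$ and $\phi\in\left]1,\frac{1+\sqrt{5}}{2}\right]$. Set $\bar{x}_0=x_1$, $\gamma_{-1}=\phi\gamma_0$ and $\rho=\frac{1}{\phi}+\frac{1}{\phi^2}$. For $k\ge1$, consider $$\left\{\begin{aligned}\gamma_k&=\min\left\{\rho\gamma_{k-1},\ \frac{\phi^2}{4\gamma_{k-2}}\frac{\|x_k-x_{k-1}\|^2}{\|\theta\bigl(B(x_k)-B(x_{k-1})\bigr)+\sigma_B(x_k-x_{k-1})\|^2},\ \overline{\gamma}\right\}\\ \bar{x}_k&=\frac{(\phi-1)x_k+\bar{x}_{k-1}}{\phi}\\ x_{k+1}&=\operatorname{prox}_{\frac{\gamma_k\theta}{1+\gamma_k\sigma_A}g}\left(\frac{1}{1+\gamma_k\sigma_A}\bigl(\bar{x}_k-\gamma_k\sigma_Bx_k-\gamma_k\theta B(x_k)+\gamma_k(\sigma_A+\sigma_B)q\bigr)\right).\end{aligned}\right.$$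 Then $(x_k)$ and $(\bar{x}_k)$ converge to $J_{\frac{\theta}{\sigma_A+\sigma_B}(\partial g+B)}(q)$.
   Context: A function $g$ is $\alpha$-convex ($\alpha\in\mathbb{R}$) if $g-\frac{\alpha}{2}\|\cdot\|^2$ is convex. $\partial g$ denotes the Fréchet subdifferential: for $x\in\operatorname{dom}g$, $\partial g(x)$ is the set of $u$ with $\liminf_{y\to x,\,y\ne x}\frac{g(y)-g(x)-\langle u,y-x\rangle}{\|y-x\|}\ge0$, and $\partial g(x)=\emptyset$ for $x\notin\operatorname{dom}g$. For $\gamma>0$, $\operatorname{prox}_{\gamma g}(x):=\operatorname{argmin}_{u\in\mathcal{H}}\left(g(u)+\frac{1}{2\gamma}\|x-u\|^2\right)$. $B$ is $\alpha$-monotone if $\langle x-y,B(x)-B(y)\rangle\ge\alpha\|x-y\|^2$ for all $x,y\in\mathcal{H}$; it is locally Lipschitz continuous if for every $x_0\in\mathcal{H}$ there exist $\delta,\kappa>0$ such that $\|B(y)-B(z)\|\le\kappa\|y-z\|$ for all $y,z$ in the closed ball of centre $x_0$ and radius $\delta$. The resolvent of a set-valued operator $A$ with parameter $\gamma>0$ is $J_{\gamma A}:=(\mathrm{Id}+\gamma A)^{-1}$ (a singleton $\{u\}$ is identified with $u$). Convention: when $x_k=x_{k-1}$, so that the quotient in the definition of $\gamma_k$ reads $0/0$, the quotient is interpreted as $+\infty$, i.e. that term is omitted from the minimum. *)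

theory Defs
  imports "HOL-Analysis.Analysis"
begin

definition edom :: "('a \<Rightarrow> ereal) \<Rightarrow> 'a set" where
  "edom g = {x. g x < \<infinity>}"

(* Functions into ]-\<infinity>,+\<infinity>] are ereal-valued functions avoiding -\<infinity>; that requirement is
   part of properness here. *)
definition proper :: "('a \<Rightarrow> ereal) \<Rightarrow> bool" where
  "proper g \<longleftrightarrow> (\<forall>x. g x \<noteq> -\<infinity>) \<and> edom g \<noteq> {}"

definition lower_semicontinuous :: "('a::topological_space \<Rightarrow> ereal) \<Rightarrow> bool" where
  "lower_semicontinuous g \<longleftrightarrow> (\<forall>x. g x \<le> Liminf (at x) g)"

(* The library's convex_on covers real-valued functions only.  The weights are strictly
   between 0 and 1, so no product 0 * \<infinity> occurs. *)
definition econvex :: "('a::real_vector \<Rightarrow> ereal) \<Rightarrow> bool" where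
  "econvex g \<longleftrightarrow> (\<forall>x y t. 0 < t \<longrightarrow> t < 1 \<longrightarrow>
     g ((1 - t) *\<^sub>R x + t *\<^sub>R y) \<le> ereal (1 - t) * g x + ereal t * g y)"

definition alpha_convex :: "real \<Rightarrow> ('a::real_normed_vector \<Rightarrow> ereal) \<Rightarrow> bool" where
  "alpha_convex \<alpha> g \<longleftrightarrow> econvex (\<lambda>x. g x - ereal (\<alpha> / 2 * (norm x)\<^sup>2))"

definition frechet_subdifferential :: "('a::real_inner \<Rightarrow> ereal) \<Rightarrow> 'a \<Rightarrow> 'a set" where
  "frechet_subdifferential g x =
     (if x \<in> edom g
      then {u. 0 \<le> Liminf (at x)
                   (\<lambda>y. (g y - g x - ereal (u \<bullet> (y - x))) / ereal (norm (y - x)))}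
      else {})"

definition prox :: "real \<Rightarrow> ('a::real_normed_vector \<Rightarrow> ereal) \<Rightarrow> 'a \<Rightarrow> 'a set" where
  "prox \<gamma> g x =
     {u. is_arg_min (\<lambda>u. g u + ereal (1 / (2 * \<gamma>) * (norm (x - u))\<^sup>2)) (\<lambda>_. True) u}"

definition alpha_monotone :: "real \<Rightarrow> ('a::real_inner \<Rightarrow> 'a) \<Rightarrow> bool" where
  "alpha_monotone \<alpha> B \<longleftrightarrow> (\<forall>x y. (x - y) \<bullet> (B x - B y) \<ge> \<alpha> * (norm (x - y))\<^sup>2)"

definition locally_lipschitz :: "('a::metric_space \<Rightarrow> 'b::metric_space) \<Rightarrow> bool" where
  "locally_lipschitz B \<longleftrightarrow> (\<forall>x0. \<exists>\<delta>>0. \<exists>\<kappa>>0. \<kappa>-lipschitz_on (cball x0 \<delta>) B)"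

(* (Id + \<gamma> A)^{-1} for a set-valued operator A: the set of x with q \<in> x + \<gamma> A(x). *)
definition resolvent :: "real \<Rightarrow> ('a::real_vector \<Rightarrow> 'a set) \<Rightarrow> 'a \<Rightarrow> 'a set" where
  "resolvent \<gamma> A q = {x. q \<in> (\<lambda>u. x + \<gamma> *\<^sub>R u) ` A x}"

end

theory Submission
  imports Defs
begin

text \<open>The iteration is the adaptive golden ratio algorithm for \<open>0 \<in> \<partial>h + F\<close> with
  \<open>h = \<theta> g + \<sigma>\<^sub>A/2 \<parallel>\<cdot>\<parallel>\<^sup>2 - (\<sigma>\<^sub>A + \<sigma>\<^sub>B) \<langle>q, \<cdot>\<rangle>\<close> and \<open>F = \<theta> B + \<sigma>\<^sub>B Id\<close>: the quadratic terms make
  \<open>h\<close> strongly convex and \<open>F\<close> \<open>\<beta>\<close>-strongly monotone, and the zero \<open>p\<close> of \<open>\<partial>h + F\<close> is the resolvent at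
  \<open>q\<close>.  With \<open>\<theta>\<^sub>k = \<phi> \<gamma>\<^sub>k / \<gamma>\<^sub>k\<^sub>-\<^sub>1\<close>, adding the optimality conditions of two consecutive proximal steps
  shows that the energy
  \<open>\<phi>/(\<phi>-1) \<parallel>xbar\<^sub>k - p\<parallel>\<^sup>2 + \<theta>\<^sub>k\<^sub>-\<^sub>1/2 \<parallel>x\<^sub>k - x\<^sub>k\<^sub>-\<^sub>1\<parallel>\<^sup>2\<close> drops in each step by at least
  \<open>2 \<gamma>\<^sub>k \<beta> \<parallel>x\<^sub>k - p\<parallel>\<^sup>2 + \<theta>\<^sub>k \<parallel>x\<^sub>k - xbar\<^sub>k\<parallel>\<^sup>2\<close>.  Hence the iterates are bounded; since balls are
  compact, \<open>F\<close> is Lipschitz along them, the step sizes stay away from \<open>0\<close>, and both terms of the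
  drop tend to \<open>0\<close>.\<close>

section \<open>Strongly convex functions with closed epigraph\<close>

lemma norm_convex_combination_sq:
  fixes x y :: "'a::real_inner"
  shows "(norm ((1 - t) *\<^sub>R x + t *\<^sub>R y))\<^sup>2
       = (1 - t) * (norm x)\<^sup>2 + t * (norm y)\<^sup>2 - t * (1 - t) * (norm (y - x))\<^sup>2"
  unfolding power2_norm_eq_inner
  by (simp add: inner_add_left inner_add_right inner_diff_left inner_diff_right inner_commute)
     (simp add: algebra_simps)

text \<open>An extended-valued function \<open>g\<close> is handled as a real function on the set \<open>D = edom g\<close>, its lower
  semicontinuity as closedness of the epigraph over \<open>D\<close>. The modulus may be negative.\<close>
definition modulus_convex_on :: "real \<Rightarrow> 'a::real_inner set \<Rightarrow> ('a \<Rightarrow> real) \<Rightarrow> bool" where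
  "modulus_convex_on m D h \<longleftrightarrow> convex_on D (\<lambda>x. h x - m / 2 * (norm x)\<^sup>2)"

lemma modulus_convex_on_imp_convex: "modulus_convex_on m D h \<Longrightarrow> convex D"
  by (auto simp: modulus_convex_on_def convex_on_def)

lemma modulus_convex_onD:
  assumes "modulus_convex_on m D h" "0 \<le> t" "t \<le> 1" "x \<in> D" "y \<in> D"
  shows "h ((1 - t) *\<^sub>R x + t *\<^sub>R y)
       \<le> (1 - t) * h x + t * h y - m / 2 * (t * (1 - t)) * (norm (y - x))\<^sup>2"
proof -
  have "h ((1 - t) *\<^sub>R x + t *\<^sub>R y) - m / 2 * (norm ((1 - t) *\<^sub>R x + t *\<^sub>R y))\<^sup>2
      \<le> (1 - t) * (h x - m / 2 * (norm x)\<^sup>2) + t * (h y - m / 2 * (norm y)\<^sup>2)"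
    using convex_onD[OF assms(1)[unfolded modulus_convex_on_def] assms(2-5)] by simp
  then show ?thesis
    unfolding norm_convex_combination_sq by (simp add: field_simps)
qed

lemma modulus_convex_on_0 [simp]: "modulus_convex_on 0 D h \<longleftrightarrow> convex_on D h"
  by (simp add: modulus_convex_on_def)

lemma convex_on_norm_sq:
  assumes "convex D" "0 \<le> c" shows "convex_on D (\<lambda>x::'a::real_inner. c * (norm x)\<^sup>2)"
proof (rule convex_onI[OF _ assms(1)])
  fix t :: real and x y :: 'a
  assume "0 < t" "t < 1"
  then have "0 \<le> c * (t * (1 - t) * (norm (y - x))\<^sup>2)" using assms(2) by simp
  then show "c * (norm ((1 - t) *\<^sub>R x + t *\<^sub>R y))\<^sup>2
     \<le> (1 - t) * (c * (norm x)\<^sup>2) + t * (c * (norm y)\<^sup>2)"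
    unfolding norm_convex_combination_sq by (simp add: algebra_simps)
qed

lemma modulus_convex_on_mono:
  assumes "modulus_convex_on m D h" "m' \<le> m"
  shows "modulus_convex_on m' D h"
proof -
  have "convex_on D (\<lambda>x. (h x - m / 2 * (norm x)\<^sup>2) + (m - m') / 2 * (norm x)\<^sup>2)"
    using assms modulus_convex_on_imp_convex[OF assms(1)]
    by (intro convex_on_add convex_on_norm_sq) (auto simp: modulus_convex_on_def)
  then show ?thesis by (simp add: modulus_convex_on_def field_simps)
qed

lemma convex_on_affine:
  assumes "convex D"
  shows "convex_on D (\<lambda>x. w \<bullet> x + (c::real))"
  by (rule convex_onI[OF _ assms]) (simp add: inner_add_right algebra_simps)

text \<open>The square centred at \<open>z\<close> differs from \<open>(norm x)\<^sup>2\<close> by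
  an affine function, so the modulus shifts by exactly \<open>c\<close>, whatever its sign.\<close>

lemma modulus_convex_on_add_quadratic:
  assumes "modulus_convex_on m D h"
  shows "modulus_convex_on (m + c) D (\<lambda>x. h x + c / 2 * (norm (x - z))\<^sup>2)"
proof -
  have "convex_on D (\<lambda>x. (h x - m / 2 * (norm x)\<^sup>2) + ((- c *\<^sub>R z) \<bullet> x + c / 2 * (z \<bullet> z)))"
    using assms modulus_convex_on_imp_convex[OF assms]
    by (intro convex_on_add convex_on_affine) (auto simp: modulus_convex_on_def)
  moreover have "(h x - m / 2 * (norm x)\<^sup>2) + ((- c *\<^sub>R z) \<bullet> x + c / 2 * (z \<bullet> z))
     = h x + c / 2 * (norm (x - z))\<^sup>2 - (m + c) / 2 * (norm x)\<^sup>2" for x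
    unfolding power2_norm_eq_inner
    by (simp add: inner_diff_left inner_diff_right inner_commute field_simps)
  ultimately show ?thesis by (simp only: modulus_convex_on_def)
qed

lemma modulus_convex_on_add_linear:
  assumes "modulus_convex_on m D h"
  shows "modulus_convex_on m D (\<lambda>x. h x + w \<bullet> x)"
proof -
  have "convex_on D (\<lambda>x. (h x - m / 2 * (norm x)\<^sup>2) + (w \<bullet> x + 0))"
    using assms modulus_convex_on_imp_convex[OF assms]
    by (intro convex_on_add convex_on_affine) (auto simp: modulus_convex_on_def)
  then show ?thesis by (simp add: modulus_convex_on_def algebra_simps)
qed

lemma modulus_convex_on_cmul:
  assumes "modulus_convex_on m D h" "0 \<le> c"
  shows "modulus_convex_on (c * m) D (\<lambda>x. c * h x)"
  using convex_on_cmul[OF assms(2) assms(1)[unfolded modulus_convex_on_def]]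
  by (simp add: modulus_convex_on_def algebra_simps)

text \<open>The new epigraph is the preimage of the old one under the continuous shear
  \<open>(x, r) \<mapsto> (x, r - k x)\<close>.\<close>

lemma closed_epigraph_add:
  assumes "closed (epigraph D h)" "continuous_on UNIV k"
  shows "closed (epigraph D (\<lambda>x. h x + k x))"
proof -
  have "continuous_on UNIV (\<lambda>z::'a \<times> real. (fst z, snd z - k (fst z)))"
    by (intro continuous_intros continuous_on_compose2[OF assms(2)]) auto
  then have "closed ((\<lambda>z. (fst z, snd z - k (fst z))) -` epigraph D h)"
    using assms(1) continuous_on_closed_vimage[of UNIV] by fastforce
  also have "(\<lambda>z. (fst z, snd z - k (fst z))) -` epigraph D h = epigraph D (\<lambda>x. h x + k x)"
    by (auto simp: epigraph_def)
  finally show ?thesis .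
qed

lemma closed_epigraph_cmul:
  assumes "closed (epigraph D h)" "0 < (c::real)"
  shows "closed (epigraph D (\<lambda>x. c * h x))"
proof -
  have "continuous_on UNIV (\<lambda>z::'a \<times> real. (fst z, snd z / c))"
    using assms(2) by (intro continuous_intros) auto
  then have "closed ((\<lambda>z. (fst z, snd z / c)) -` epigraph D h)"
    using assms(1) continuous_on_closed_vimage[of UNIV] by fastforce
  also have "(\<lambda>z. (fst z, snd z / c)) -` epigraph D h = epigraph D (\<lambda>x. c * h x)"
    using assms(2) by (auto simp: epigraph_def field_simps)
  finally show ?thesis .
qed

lemma closed_epigraph_restrict:
  assumes "closed (epigraph D h)" "closed C"
  shows "closed (epigraph (D \<inter> C) h)"
proof -
  have "epigraph (D \<inter> C) h = epigraph D h \<inter> C \<times> UNIV" by (auto simp: epigraph_def)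
  then show ?thesis using assms by (simp add: closed_Int closed_Times)
qed

text \<open>A ball around the point one unit below the graph at \<open>x0\<close> misses the closed
  epigraph, so \<open>h\<close> stays above \<open>h x0 - 1\<close> near \<open>x0\<close>.
  Convexity along the segment from \<open>x0\<close> to a far point turns this local bound into a
  cone below \<open>h\<close>.\<close>

lemma convex_affine_minorant_at:
  fixes h :: "'a::real_inner \<Rightarrow> real"
  assumes cv: "convex_on D h" and cl: "closed (epigraph D h)" and x0: "x0 \<in> D"
  obtains M where "0 \<le> M" "\<And>x. x \<in> D \<Longrightarrow> h x0 - 1 - M * norm (x - x0) \<le> h x"
proof -
  have "(x0, h x0 - 1) \<in> - epigraph D h" by (simp add: mem_epigraph)
  with cl obtain e where e: "e > 0" "\<And>z. dist z (x0, h x0 - 1) < e \<Longrightarrow> z \<notin> epigraph D h"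
    unfolding closed_def open_dist by blast
  have near: "h x0 - 1 < h x" if "x \<in> D" "norm (x - x0) < e" for x
    using e(2)[of "(x, h x0 - 1)"] that by (auto simp: dist_Pair_Pair mem_epigraph dist_norm)
  define d where "d = e / 2"
  have d: "0 < d" "d < e" using e(1) by (auto simp: d_def)
  have "h x0 - 1 - 1 / d * norm (x - x0) \<le> h x" if x: "x \<in> D" for x
  proof (cases "norm (x - x0) < e")
    case True
    then have "h x0 - 1 < h x" using near x by blast
    moreover have "0 \<le> 1 / d * norm (x - x0)" using d by simp
    ultimately show ?thesis by linarith
  next
    case False
    define r where "r = norm (x - x0)"
    have r: "r \<ge> e" "r > 0" using False e(1) by (auto simp: r_def)
    \<comment> \<open>This weight puts the segment point at distance \<open>d\<close> from
      \<open>x0\<close>, where \<open>near\<close> applies.\<close>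
    define t where "t = d / r"
    have t: "0 < t" "t < 1" using r d by (auto simp: t_def)
    let ?y = "(1 - t) *\<^sub>R x0 + t *\<^sub>R x"
    have "?y \<in> D" using cv x x0 t by (auto simp: convex_on_def convex_def)
    moreover have "?y - x0 = t *\<^sub>R (x - x0)" by (simp add: algebra_simps)
    then have "norm (?y - x0) = d" using t r d by (simp add: r_def[symmetric]) (simp add: t_def)
    ultimately have "h x0 - 1 < h ?y" using near d by simp
    also have "\<dots> \<le> (1 - t) * h x0 + t * h x"
      using convex_onD[OF cv, of t x0 x] t x x0 by simp
    finally have "t * (h x0 - h x) < 1" by (simp add: algebra_simps)
    then have "h x0 - h x < r / d" using t r d by (simp add: t_def field_simps)
    then show ?thesis by (simp add: r_def)
  qed
  then show thesis using that[of "1 / d"] d by simp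
qed

text \<open>Convexity along the segment from \<open>p\<close> to \<open>y\<close>, divided by the
  weight \<open>t\<close>, leaves a factor \<open>1 - t\<close> that disappears as \<open>t\<close>
  tends to 0.\<close>

lemma modulus_convex_on_minimizer_growth:
  assumes sc: "modulus_convex_on m D h" and p: "p \<in> D" and min: "\<And>y. y \<in> D \<Longrightarrow> h p \<le> h y"
    and y: "y \<in> D"
  shows "h p + m / 2 * (norm (y - p))\<^sup>2 \<le> h y"
proof -
  have "\<forall>\<^sub>F t in at_right (0::real). m / 2 * (1 - t) * (norm (y - p))\<^sup>2 \<le> h y - h p"
    unfolding eventually_at_right_field
  proof (intro exI[of _ 1] conjI allI impI)
    fix t :: real assume t: "0 < t" "t < 1"
    have "(1 - t) *\<^sub>R p + t *\<^sub>R y \<in> D"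
      using modulus_convex_on_imp_convex[OF sc] p y t by (auto simp: convex_def)
    then have "h p \<le> (1 - t) * h p + t * h y - m / 2 * (t * (1 - t)) * (norm (y - p))\<^sup>2"
      using modulus_convex_onD[OF sc, of t p y] t p y min by fastforce
    then have "t * (m / 2 * (1 - t) * (norm (y - p))\<^sup>2) \<le> t * (h y - h p)"
      by (simp add: algebra_simps)
    then show "m / 2 * (1 - t) * (norm (y - p))\<^sup>2 \<le> h y - h p"
      using t by simp
  qed simp
  moreover have "((\<lambda>t. m / 2 * (1 - t) * (norm (y - p))\<^sup>2) \<longlongrightarrow> m / 2 * (1 - 0) * (norm (y - p))\<^sup>2)
     (at_right (0::real))"
    by (intro tendsto_intros)
  ultimately have "m / 2 * (1 - 0) * (norm (y - p))\<^sup>2 \<le> h y - h p"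
    by (intro tendsto_upperbound) auto
  then show ?thesis by simp
qed

text \<open>Completeness replaces compactness: closed sublevel sets just above the infimum are
  nested, and strong convexity makes their diameters tend to 0, so they share a point.\<close>

lemma strongly_convex_minimizer_exists:
  fixes h :: "'a::{real_inner,complete_space} \<Rightarrow> real"
  assumes sc: "modulus_convex_on m D h" and m: "m > 0" and cl: "closed (epigraph D h)"
    and ne: "D \<noteq> {}"
  shows "\<exists>p\<in>D. \<forall>y\<in>D. h p \<le> h y"
proof -
  obtain x0 where x0: "x0 \<in> D" using ne by blast
  \<comment> \<open>Without its quadratic part \<open>h\<close> is still convex with closed epigraph
    and so has a cone minorant. The quadratic absorbs the linear decay of the cone, which bounds
    \<open>h\<close> below.\<close>
  define k where "k x = h x - m / 2 * (norm x)\<^sup>2" for x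
  have "continuous_on UNIV (\<lambda>x::'a. - (m / 2 * (norm x)\<^sup>2))"
    by (intro continuous_intros)
  from closed_epigraph_add[OF cl this] have clk: "closed (epigraph D k)"
    by (simp add: k_def[abs_def])
  have cvk: "convex_on D k" using sc by (simp add: modulus_convex_on_def k_def[abs_def])
  obtain M where M: "M \<ge> 0" "\<And>x. x \<in> D \<Longrightarrow> k x0 - 1 - M * norm (x - x0) \<le> k x"
    using convex_affine_minorant_at[OF cvk clk x0] by blast
  have lower: "k x0 - 1 - M * norm x0 - M\<^sup>2 / (2 * m) \<le> h x" if "x \<in> D" for x
  proof -
    have "M * norm (x - x0) \<le> M * (norm x + norm x0)"
      using M(1) norm_triangle_ineq4 mult_left_mono by blast
    moreover have "0 \<le> (m * norm x - M)\<^sup>2 / (2 * m)" using m by simp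
    then have "M * norm x \<le> m / 2 * (norm x)\<^sup>2 + M\<^sup>2 / (2 * m)"
      using m by (simp add: power2_eq_square field_simps)
    ultimately show ?thesis using M(2)[OF that] by (simp add: k_def algebra_simps)
  qed
  define I where "I = Inf (h ` D)"
  have bdd: "bdd_below (h ` D)" using lower by (auto intro!: bdd_belowI)
  have I: "I \<le> h x" if "x \<in> D" for x using bdd that by (auto simp: I_def intro: cInf_lower)
  define S where "S n = {x \<in> D. h x \<le> I + 1 / real (Suc n)}" for n
  have "\<exists>a. \<Inter>(range S) = {a}"
  proof (rule decreasing_closed_nest_sing)
    fix n
    have "S n = (\<lambda>x. (x, I + 1 / real (Suc n))) -` epigraph D h"
      by (auto simp: S_def mem_epigraph)
    moreover have "closed ((\<lambda>x. (x, I + 1 / real (Suc n))) -` epigraph D h)"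
      by (intro closed_vimage[OF cl] continuous_intros)
    ultimately show "closed (S n)" by simp
    have "Inf (h ` D) < I + 1 / real (Suc n)" unfolding I_def by simp
    from cInf_lessD[OF _ this] ne obtain z where "z \<in> D" "h z < I + 1 / real (Suc n)" by auto
    then have "z \<in> S n" by (simp add: S_def)
    then show "S n \<noteq> {}" by blast
  next
    fix i n :: nat assume "i \<le> n"
    then have "1 / real (Suc n) \<le> 1 / real (Suc i)" by (simp add: field_simps)
    then show "S n \<subseteq> S i" unfolding S_def by force
  next
    fix e :: real assume e: "e > 0"
    \<comment> \<open>\<open>m / 8\<close> is \<open>m / 2 * (t * (1 - t))\<close> at
      \<open>t = 1/2\<close>: the convexity gain at the midpoint of two points of \<open>S n\<close>
      is at most \<open>1 / real (Suc n)\<close>, since the midpoint value is at least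
      \<open>I\<close>.\<close>
    then obtain n where n: "inverse (real (Suc n)) < m / 8 * e\<^sup>2"
      using reals_Archimedean[of "m / 8 * e\<^sup>2"] m by auto
    have "dist x y < e" if x: "x \<in> S n" and y: "y \<in> S n" for x y
    proof -
      have D: "x \<in> D" "y \<in> D" using x y by (auto simp: S_def)
      have "(1 - 1/2) *\<^sub>R x + (1/2::real) *\<^sub>R y \<in> D"
        using modulus_convex_on_imp_convex[OF sc] D unfolding convex_alt
        by (auto elim!: ballE allE[of _ "1/2"])
      then have "I \<le> (1 - 1/2) * h x + 1/2 * h y - m / 2 * (1/2 * (1 - 1/2)) * (norm (y - x))\<^sup>2"
        using modulus_convex_onD[OF sc, of "1/2" x y] D I by fastforce
      moreover have "h x \<le> I + 1 / real (Suc n)" "h y \<le> I + 1 / real (Suc n)"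
        using x y by (auto simp: S_def)
      ultimately have "m / 8 * (norm (y - x))\<^sup>2 \<le> 1 / real (Suc n)" by simp
      then have "m / 8 * (norm (y - x))\<^sup>2 < m / 8 * e\<^sup>2" using n by (simp add: inverse_eq_divide)
      then have "(norm (y - x))\<^sup>2 < e\<^sup>2" using m by simp
      then show ?thesis using e by (simp add: dist_norm norm_minus_commute power_less_imp_less_base)
    qed
    then show "\<exists>n. \<forall>x\<in>S n. \<forall>y\<in>S n. dist x y < e" by blast
  qed
  then obtain p where "\<Inter>(range S) = {p}" by blast
  then have p: "p \<in> S n" for n by blast
  then have "p \<in> D" by (auto simp: S_def)
  moreover have "(\<lambda>n. I + 1 / real (Suc n)) \<longlonglongrightarrow> I + 0"
    by (intro tendsto_intros LIMSEQ_Suc lim_1_over_n)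
  then have "h p \<le> I + 0"
    by (rule tendsto_lowerbound) (use p in \<open>auto simp: S_def\<close>)
  ultimately show ?thesis using I by force
qed

text \<open>Quadratic growth of \<open>h + \<parallel>\<cdot> - z\<parallel>\<^sup>2 / (2 c)\<close> at its minimiser, rewritten with the three-point identity.\<close>
lemma proximal_inequality:
  fixes h :: "'a::real_inner \<Rightarrow> real"
  assumes sc: "modulus_convex_on m D h" and c: "0 < c" and p: "p \<in> D"
    and min: "\<And>y. y \<in> D \<Longrightarrow> h p + 1 / c / 2 * (norm (p - z))\<^sup>2 \<le> h y + 1 / c / 2 * (norm (y - z))\<^sup>2"
    and y: "y \<in> D"
  shows "(z - p) \<bullet> (y - p) + c * m / 2 * (norm (y - p))\<^sup>2 \<le> c * (h y - h p)"
proof -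
  have *: "h p + 1 / c / 2 * (norm (p - z))\<^sup>2 + (m + 1 / c) / 2 * (norm (y - p))\<^sup>2
      \<le> h y + 1 / c / 2 * (norm (y - z))\<^sup>2"
    using modulus_convex_on_minimizer_growth[OF modulus_convex_on_add_quadratic[OF sc] p min y] .
  have "(norm (p - z))\<^sup>2 + (norm (y - p))\<^sup>2 - (norm (y - z))\<^sup>2 = 2 * ((z - p) \<bullet> (y - p))"
    unfolding power2_norm_eq_inner
    by (simp add: inner_diff_left inner_diff_right inner_commute)
  moreover have "2 * c * (h p + 1 / c / 2 * (norm (p - z))\<^sup>2 + (m + 1 / c) / 2 * (norm (y - p))\<^sup>2)
      \<le> 2 * c * (h y + 1 / c / 2 * (norm (y - z))\<^sup>2)"
    using * c by (intro mult_left_mono) auto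
  then have "2 * c * h p + (norm (p - z))\<^sup>2 + (norm (y - p))\<^sup>2 - (norm (y - z))\<^sup>2 + c * m * (norm (y - p))\<^sup>2
     \<le> 2 * c * h y"
    using c by (simp add: distrib_left distrib_right add_divide_distrib)
  ultimately have "2 * ((z - p) \<bullet> (y - p)) + c * m * (norm (y - p))\<^sup>2 \<le> 2 * (c * h y - c * h p)"
    by (simp add: algebra_simps)
  then show ?thesis by (simp add: right_diff_distrib)
qed

section \<open>Lipschitz bounds on balls of a finite-dimensional space\<close>

text \<open>Induction on \<open>C\<close>: each further vector adds a compact segment, and Minkowski
  sums of compact sets are compact.\<close>

lemma compact_bounded_combinations:
  fixes C :: "'a::real_normed_vector set"
  assumes "finite C"
  shows "compact {\<Sum>c\<in>C. u c *\<^sub>R c | u. \<forall>c\<in>C. \<bar>u c\<bar> \<le> (K::real)}"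
  using assms
proof (induction C)
  case (insert c C)
  let ?T = "\<lambda>C. {\<Sum>c\<in>C. u c *\<^sub>R c | u. \<forall>c\<in>C. \<bar>u c\<bar> \<le> K}"
  let ?S = "(\<lambda>t. t *\<^sub>R c) ` {-K..K}"
  have "?T (insert c C) = {a + b | a b. a \<in> ?S \<and> b \<in> ?T C}" (is "?L = ?R")
  proof (intro equalityI subsetI)
    fix z assume "z \<in> ?L"
    then obtain u where u: "z = (\<Sum>c\<in>insert c C. u c *\<^sub>R c)" "\<forall>c\<in>insert c C. \<bar>u c\<bar> \<le> K" by blast
    have "z = u c *\<^sub>R c + (\<Sum>c\<in>C. u c *\<^sub>R c)" using u(1) insert by simp
    moreover have "u c *\<^sub>R c \<in> ?S" using u(2) by (auto simp: abs_le_iff)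
    ultimately show "z \<in> ?R" using u(2) by blast
  next
    fix z assume "z \<in> ?R"
    then obtain b t where bt: "z = t *\<^sub>R c + b" "t \<in> {-K..K}" "b \<in> ?T C" by blast
    then obtain u where "b = (\<Sum>c\<in>C. u c *\<^sub>R c)" "\<forall>c\<in>C. \<bar>u c\<bar> \<le> K" by blast
    with bt have t: "\<bar>t\<bar> \<le> K" "\<forall>c\<in>C. \<bar>u c\<bar> \<le> K" "z = t *\<^sub>R c + (\<Sum>c\<in>C. u c *\<^sub>R c)"
      by (auto simp: abs_le_iff)
    have "(\<Sum>d\<in>C. (u(c := t)) d *\<^sub>R d) = (\<Sum>c\<in>C. u c *\<^sub>R c)"
      using insert by (intro sum.cong) auto
    then have "z = (\<Sum>d\<in>insert c C. (u(c := t)) d *\<^sub>R d)" using t(3) insert by simp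
    moreover have "\<forall>d\<in>insert c C. \<bar>(u(c := t)) d\<bar> \<le> K" using t by auto
    ultimately show "z \<in> ?L" by blast
  qed
  moreover have "compact ?S"
    by (intro compact_continuous_image continuous_intros) auto
  ultimately show ?case using compact_sums[OF _ insert.IH, of ?S] by metis
qed simp

text \<open>For an orthogonal spanning set, Cauchy-Schwarz bounds the coefficients of the vectors in
  a ball, so the ball is a closed subset of a compact set of bounded combinations.\<close>

lemma compact_cball_finite_span:
  fixes x :: "'a::real_inner"
  assumes "finite S" and "span S = (UNIV :: 'a set)"
  shows "compact (cball x r)"
proof -
  obtain C :: "'a set" where C: "finite C" "span C = UNIV" "pairwise orthogonal C"
    using basis_orthogonal[OF assms(1)] assms(2) by metis
  define R where "R = norm x + \<bar>r\<bar>"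
  \<comment> \<open>Summing the reciprocals gives one bound for all of \<open>C\<close>; a zero
    vector in \<open>C\<close> contributes \<open>1 / 0 = 0\<close>.\<close>
  define K where "K = R * (\<Sum>c\<in>C. 1 / norm c)"
  have K: "R / norm c \<le> K" if "c \<in> C" for c
    using member_le_sum[OF that, of "\<lambda>c. 1 / norm c"] C(1)
      mult_left_mono[of "1 / norm c" "\<Sum>c\<in>C. 1 / norm c" R] by (simp add: K_def R_def)
  have "cball 0 R \<subseteq> {\<Sum>c\<in>C. u c *\<^sub>R c | u. \<forall>c\<in>C. \<bar>u c\<bar> \<le> K}"
  proof
    fix y :: 'a assume y: "y \<in> cball 0 R"
    have "y \<in> span C" using C by simp
    then obtain u where u: "y = (\<Sum>c\<in>C. u c *\<^sub>R c)" using span_finite[OF C(1)] by auto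
    \<comment> \<open>If \<open>0 \<in> C\<close>, its coefficient is arbitrary and is reset to
      0.\<close>
    define w where "w c = (if c = 0 then 0 else u c)" for c
    have w: "y = (\<Sum>c\<in>C. w c *\<^sub>R c)" unfolding u w_def by (intro sum.cong) auto
    have "\<bar>w c\<bar> \<le> K" if c: "c \<in> C" for c
    proof (cases "c = 0")
      case True then show ?thesis using K[OF c] by (simp add: w_def)
    next
      case False
      have "y \<bullet> c = (\<Sum>d\<in>C. w d * (d \<bullet> c))" by (simp add: w inner_sum_left)
      also have "\<dots> = (\<Sum>d\<in>C. if d = c then w c * (c \<bullet> c) else 0)"
        using C(3) c by (intro sum.cong) (auto simp: pairwise_def orthogonal_def)
      finally have "y \<bullet> c = w c * (norm c)\<^sup>2"
        using C(1) c by (simp add: power2_norm_eq_inner)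
      then have "\<bar>w c\<bar> * (norm c)\<^sup>2 \<le> norm y * norm c"
        using Cauchy_Schwarz_ineq2[of y c] by (simp add: abs_mult)
      also have "\<dots> \<le> R * norm c" using y by (intro mult_right_mono) auto
      finally have "\<bar>w c\<bar> \<le> R / norm c" using False by (simp add: power2_eq_square field_simps)
      then show ?thesis using K[OF c] by linarith
    qed
    then show "y \<in> {\<Sum>c\<in>C. u c *\<^sub>R c | u. \<forall>c\<in>C. \<bar>u c\<bar> \<le> K}" using w by blast
  qed
  moreover have "cball x r \<subseteq> cball 0 R"
    using norm_triangle_ineq2 by (auto simp: R_def dist_norm norm_minus_commute)
       (smt (verit) norm_triangle_ineq2 norm_minus_commute)
  ultimately show ?thesis
    using compact_Int_closed[OF compact_bounded_combinations[OF C(1), of K] closed_cball[of x r]]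
    by (metis (no_types, lifting) inf.absorb2 order_trans)
qed

text \<open>\<open>B\<close> is viewed as a family over the single time 0, so that the passage from
  \<open>local_lipschitz\<close> to a uniform constant on compact sets applies.\<close>

lemma locally_lipschitz_imp_lipschitz_on_compact:
  fixes B :: "'a::metric_space \<Rightarrow> 'b::metric_space"
  assumes "locally_lipschitz B" "compact K"
  obtains L where "L-lipschitz_on K B"
proof -
  have "local_lipschitz {0::real} K (\<lambda>_. B)"
    unfolding local_lipschitz_def
  proof (intro ballI)
    fix x assume "x \<in> K"
    obtain d k where "d > 0" "k-lipschitz_on (cball x d) B"
      using assms(1) unfolding locally_lipschitz_def by blast
    then show "\<exists>u>0. \<exists>L. \<forall>t\<in>cball t u \<inter> {0}. L-lipschitz_on (cball x u \<inter> K) B" for t :: real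
      using lipschitz_on_subset[of k "cball x d" B "cball x d \<inter> K"] by auto
  qed
  then obtain L where "\<And>t. t \<in> {0::real} \<Longrightarrow> L-lipschitz_on K B"
    by (rule local_lipschitz_compact_implies_lipschitz[OF _ assms(2), of "{0}" "\<lambda>_. B"]) auto
  then show thesis using that by blast
qed

section \<open>Variational inequalities for strongly monotone maps\<close>

lemma norm_diff_sq_expand:
  fixes a b :: "'a::real_inner"
  shows "(norm (a - b))\<^sup>2 = (norm a)\<^sup>2 - 2 * (a \<bullet> b) + (norm b)\<^sup>2"
  unfolding power2_norm_eq_inner by (simp add: inner_diff_left inner_diff_right inner_commute)

text \<open>On a large ball the forward-backward map is a contraction; its fixed point solves the
  variational inequality localised to that ball. Strong monotonicity keeps the fixed point away
  from the boundary, so convexity removes the localisation.\<close>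
lemma strongly_monotone_vi_solution_exists:
  fixes h :: "'a::{real_inner,complete_space} \<Rightarrow> real" and F :: "'a \<Rightarrow> 'a"
  assumes cv: "convex_on D h" and cl: "closed (epigraph D h)" and ne: "D \<noteq> {}" and \<beta>: "0 < \<beta>"
    and mono: "\<And>x y. \<beta> * (norm (x - y))\<^sup>2 \<le> (x - y) \<bullet> (F x - F y)"
    and lip: "\<And>z r. \<exists>L. L-lipschitz_on (cball z r) F"
  obtains p where "p \<in> D" "\<And>y. y \<in> D \<Longrightarrow> h p \<le> h y + F p \<bullet> (y - p)"
proof -
  obtain x0 where x0: "x0 \<in> D" using ne by blast
  obtain M where M: "0 \<le> M" "\<And>x. x \<in> D \<Longrightarrow> h x0 - 1 - M * norm (x - x0) \<le> h x"
    using convex_affine_minorant_at[OF cv cl x0] by blast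
  \<comment> \<open>The radius makes \<open>\<beta> * R\<close> exceed
    \<open>1 + M + norm (F x0)\<close>, which later excludes a fixed point on the boundary.\<close>
  define R where "R = 1 + (1 + M + norm (F x0)) / \<beta>"
  have R: "1 \<le> R" "\<beta> * R = \<beta> + 1 + M + norm (F x0)"
    using \<beta> M(1) by (auto simp: R_def field_simps)
  define C where "C = cball x0 R"
  obtain L0 where L0: "L0-lipschitz_on C F" using lip C_def by blast
  define L where "L = max L0 \<beta>"
  have L: "L-lipschitz_on C F" "\<beta> \<le> L" "0 < L"
    using L0 \<beta> lipschitz_on_le[of L0 C F L] by (auto simp: L_def)
  \<comment> \<open>This step length minimises the squared contraction factor
    \<open>1 - 2 * c * \<beta> + c\<^sup>2 * L\<^sup>2\<close>. The minimum
    \<open>1 - \<beta>\<^sup>2 / L\<^sup>2\<close> is nonnegative because \<open>L\<close> was taken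
    at least \<open>\<beta>\<close>.\<close>
  define c where "c = \<beta> / L\<^sup>2"
  have c: "0 < c" using \<beta> L by (simp add: c_def)
  have D': "convex (D \<inter> C)" "x0 \<in> D \<inter> C"
    using cv x0 R by (auto simp: C_def convex_on_def convex_Int)
  have sc: "modulus_convex_on 0 (D \<inter> C) h"
    using convex_on_subset[OF cv] D' by simp
  have "\<exists>u\<in>D \<inter> C. \<forall>y\<in>D \<inter> C. (z - u) \<bullet> (y - u) \<le> c * (h y - h u)" for z
  proof -
    have "\<exists>u\<in>D \<inter> C. \<forall>y\<in>D \<inter> C. h u + 1 / c / 2 * (norm (u - z))\<^sup>2 \<le> h y + 1 / c / 2 * (norm (y - z))\<^sup>2"
    proof (rule strongly_convex_minimizer_exists[of "0 + 1 / c"])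
      show "modulus_convex_on (0 + 1 / c) (D \<inter> C) (\<lambda>x. h x + 1 / c / 2 * (norm (x - z))\<^sup>2)"
        by (rule modulus_convex_on_add_quadratic[OF sc])
      show "closed (epigraph (D \<inter> C) (\<lambda>x. h x + 1 / c / 2 * (norm (x - z))\<^sup>2))"
        by (intro closed_epigraph_add closed_epigraph_restrict cl continuous_intros) (simp add: C_def)
    qed (use c D' in auto)
    then show ?thesis using proximal_inequality[OF sc c, of _ z] by fastforce
  qed
  \<comment> \<open>\<open>P\<close> is the proximal map of \<open>c * h\<close> restricted to
    \<open>D \<inter> C\<close>, known through its variational inequality. Adding that inequality at
    two points makes \<open>P\<close> nonexpansive.\<close>
  then obtain P where P: "\<And>z. P z \<in> D \<inter> C"
      "\<And>z y. y \<in> D \<inter> C \<Longrightarrow> (z - P z) \<bullet> (y - P z) \<le> c * (h y - h (P z))"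
    by metis
  have P_nonexp: "norm (P z - P w) \<le> norm (z - w)" for z w
  proof -
    have "(z - P z) \<bullet> (P w - P z) + (w - P w) \<bullet> (P z - P w) \<le> 0"
      using P(2)[OF P(1), of z w] P(2)[OF P(1), of w z] by (simp add: algebra_simps)
    then have "(norm (P z - P w))\<^sup>2 \<le> (z - w) \<bullet> (P z - P w)"
      unfolding power2_norm_eq_inner by (simp add: inner_diff_left inner_diff_right inner_commute)
    also have "\<dots> \<le> norm (z - w) * norm (P z - P w)" by (rule norm_cauchy_schwarz)
    finally have "norm (P z - P w) * norm (P z - P w) \<le> norm (z - w) * norm (P z - P w)"
      by (simp add: power2_eq_square)
    then show ?thesis
      by (metis mult_le_cancel_right norm_ge_zero norm_le_zero_iff order_trans not_less norm_not_less_zero)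
  qed
  define k where "k = 1 - \<beta>\<^sup>2 / L\<^sup>2"
  have "\<beta>\<^sup>2 \<le> L\<^sup>2" using L(2) \<beta> by (intro power_mono) auto
  then have k: "0 \<le> k" "k < 1" using \<beta> L(3) by (auto simp: k_def)
  define T where "T x = P (x - c *\<^sub>R F x)" for x
  have contr: "dist (T x) (T y) \<le> sqrt k * dist x y" if "x \<in> C" "y \<in> C" for x y
  proof -
    have FL: "norm (F x - F y) \<le> L * norm (x - y)"
      using lipschitz_onD[OF L(1) that] by (simp add: dist_norm)
    have "(norm (T x - T y))\<^sup>2 \<le> (norm ((x - c *\<^sub>R F x) - (y - c *\<^sub>R F y)))\<^sup>2"
      unfolding T_def by (intro power_mono P_nonexp) auto
    also have "\<dots> = (norm ((x - y) - c *\<^sub>R (F x - F y)))\<^sup>2" by (simp add: algebra_simps)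
    also have "\<dots> = (norm (x - y))\<^sup>2 - 2 * c * ((x - y) \<bullet> (F x - F y)) + c\<^sup>2 * (norm (F x - F y))\<^sup>2"
      by (simp add: norm_diff_sq_expand power_mult_distrib)
    also have "\<dots> \<le> (norm (x - y))\<^sup>2 - 2 * c * (\<beta> * (norm (x - y))\<^sup>2) + c\<^sup>2 * (L * norm (x - y))\<^sup>2"
      using mono[of x y] FL c by (intro add_mono diff_mono mult_left_mono power_mono) auto
    also have "\<dots> = k * (norm (x - y))\<^sup>2"
      using L(3) by (simp add: k_def c_def power2_eq_square field_simps)
    also have "\<dots> = (sqrt k * norm (x - y))\<^sup>2" using k by (simp add: power_mult_distrib)
    finally have "norm (T x - T y) \<le> sqrt k * norm (x - y)"
      by (rule power2_le_imp_le) (use k in simp)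
    then show ?thesis by (simp add: dist_norm)
  qed
  have "\<exists>!x\<in>C. T x = x"
    by (rule Banach_fix[where c = "sqrt k"])
      (use k contr P(1) R in \<open>auto simp: T_def C_def complete_eq_closed\<close>)
  then obtain p where pC: "p \<in> C" and Tp: "T p = p" by blast
  have pD: "p \<in> D" using P(1) Tp by (metis IntD1 T_def)
  have loc: "h p \<le> h y + F p \<bullet> (y - p)" if "y \<in> D" "y \<in> C" for y
  proof -
    have "c * (- (F p \<bullet> (y - p))) \<le> c * (h y - h p)"
      using P(2)[of y "p - c *\<^sub>R F p"] that Tp by (simp add: T_def)
    then have "- (F p \<bullet> (y - p)) \<le> h y - h p" using c mult_le_cancel_left_pos by blast
    then show ?thesis by simp
  qed
  define r where "r = norm (p - x0)"
  \<comment> \<open>Testing with \<open>x0\<close> and using strong monotonicity bounds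
    \<open>\<beta> * r\<^sup>2\<close> by an affine function of \<open>r\<close>, which is
    impossible once \<open>r \<ge> R\<close>.\<close>
  have "r < R"
  proof (rule ccontr)
    assume "\<not> r < R"
    with R have r: "R \<le> r" "1 \<le> r" by auto
    have "\<beta> * r\<^sup>2 \<le> (p - x0) \<bullet> (F p - F x0)" using mono[of p x0] by (simp add: r_def)
    moreover have "h p \<le> h x0 - F p \<bullet> (p - x0)"
      using loc[OF x0] D' by (simp add: inner_diff_right)
    moreover have "h x0 - 1 - M * r \<le> h p" using M(2)[OF pD] by (simp add: r_def)
    moreover have "- (F x0 \<bullet> (p - x0)) \<le> norm (F x0) * r"
      using norm_cauchy_schwarz[of "- F x0" "p - x0"] by (simp add: r_def)
    ultimately have "\<beta> * r\<^sup>2 \<le> 1 + (M + norm (F x0)) * r"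
      by (simp add: inner_diff_right inner_diff_left inner_commute algebra_simps)
    also have "\<dots> \<le> (1 + M + norm (F x0)) * r" using r by (simp add: algebra_simps)
    also have "\<dots> < (\<beta> * R) * r" using R \<beta> r by (intro mult_strict_right_mono) auto
    also have "\<dots> \<le> \<beta> * r\<^sup>2" using r \<beta> by (simp add: power2_eq_square)
    finally show False by simp
  qed
  have "h p \<le> h y + F p \<bullet> (y - p)" if y: "y \<in> D" for y
  proof -
    define s where "s = norm (y - p)"
    \<comment> \<open>\<open>t\<close> keeps the segment point within \<open>R - r\<close> of
      \<open>p\<close>, hence in \<open>C\<close>; convexity of \<open>h\<close> carries the
      inequality from there to \<open>y\<close>. The denominator is positive even for
      \<open>y = p\<close>.\<close>
    define t where "t = (R - r) / (R - r + s)"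
    have s: "0 \<le> s" "0 < R - r + s" using \<open>r < R\<close> by (auto simp: s_def intro: add_pos_nonneg)
    then have t: "0 < t" "t \<le> 1" using \<open>r < R\<close> by (auto simp: t_def)
    have "(R - r) * (s / (R - r + s)) \<le> (R - r) * 1"
      using s \<open>r < R\<close> by (intro mult_left_mono) auto
    then have ts: "t * s \<le> R - r" by (simp add: t_def)
    let ?y = "(1 - t) *\<^sub>R p + t *\<^sub>R y"
    have "?y \<in> D" using cv pD y t by (auto simp: convex_on_def convex_def)
    moreover have yp: "?y - p = t *\<^sub>R (y - p)" by (simp add: algebra_simps)
    moreover have "norm (?y - x0) \<le> norm (?y - p) + norm (p - x0)"
      by (metis diff_add_cancel add_diff_eq norm_triangle_ineq)
    then have "?y \<in> C" unfolding yp using t ts by (simp add: C_def dist_norm norm_minus_commute s_def r_def)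
    ultimately have "h p \<le> h ?y + t * (F p \<bullet> (y - p))" using loc[of ?y] by simp
    also have "\<dots> \<le> (1 - t) * h p + t * h y + t * (F p \<bullet> (y - p))"
      using convex_onD[OF cv, of t p y] t pD y by simp
    finally have "t * h p \<le> t * (h y + F p \<bullet> (y - p))" by (simp add: algebra_simps)
    then show ?thesis using t by simp
  qed
  then show thesis using that pD by blast
qed

section \<open>The adaptive golden ratio algorithm\<close>

lemma telescoping_decrease_tendsto_0:
  fixes E a :: "nat \<Rightarrow> real"
  assumes "\<And>k. 0 \<le> E k" "\<And>k. 0 \<le> a k" "\<And>k. E (Suc k) + a k \<le> E k"
  shows "a \<longlonglongrightarrow> 0"
proof -
  have "decseq E" using assms(2,3) by (intro decseq_SucI) (smt (verit))
  with assms(1) obtain l where "E \<longlonglongrightarrow> l" using decseq_convergent by blast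
  then have "(\<lambda>k. E k - E (Suc k)) \<longlonglongrightarrow> l - l" by (intro tendsto_diff LIMSEQ_Suc)
  then have "(\<lambda>k. E k - E (Suc k)) \<longlonglongrightarrow> 0" by simp
  moreover have "norm (a k) \<le> E k - E (Suc k)" for k
    using assms(2,3)[of k] by simp
  ultimately show ?thesis
    using Lim_null_comparison[of a "\<lambda>k. E k - E (Suc k)" sequentially] by simp
qed

text \<open>In the sum of \<open>new\<close>, \<open>l2\<close> times \<open>strong\<close> and
  \<open>l2 / l1\<close> times \<open>old\<close> all values of \<open>h\<close> cancel, and
  polarisation turns the inner products into squared distances. \<open>old\<close> is the previous
  proximal step tested at the new iterate.\<close>

lemma graal_energy_step:
  fixes p x0 x1 x2 v0 v1 v2 f0 f1 :: "'a::real_inner"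
  assumes phi: "1 < \<phi>" and l: "0 < l0" "0 < l1" "0 < l2"
    and v1: "\<phi> *\<^sub>R v1 = (\<phi> - 1) *\<^sub>R x1 + v0"
    and v2: "\<phi> *\<^sub>R v2 = (\<phi> - 1) *\<^sub>R x2 + v1"
    and new: "(v1 - l2 *\<^sub>R f1 - x2) \<bullet> (p - x2) \<le> l2 * (hp - h2)"
    and old: "(v0 - l1 *\<^sub>R f0 - x1) \<bullet> (x2 - x1) \<le> l1 * (h2 - h1)"
    and strong: "\<beta> * (norm (x1 - p))\<^sup>2 \<le> f1 \<bullet> (x1 - p) + h1 - hp"
    and growth: "l2 \<le> (1 / \<phi> + 1 / \<phi>\<^sup>2) * l1"
    and curv: "4 * l2 * l0 * (norm (f1 - f0))\<^sup>2 \<le> \<phi>\<^sup>2 * (norm (x1 - x0))\<^sup>2"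
  shows "\<phi> / (\<phi> - 1) * (norm (v2 - p))\<^sup>2 + \<phi> * l2 / l1 / 2 * (norm (x2 - x1))\<^sup>2
       + (2 * l2 * \<beta> * (norm (x1 - p))\<^sup>2 + \<phi> * l2 / l1 * (norm (x1 - v1))\<^sup>2)
      \<le> \<phi> / (\<phi> - 1) * (norm (v1 - p))\<^sup>2 + \<phi> * l1 / l0 / 2 * (norm (x1 - x0))\<^sup>2"
proof -
  define th1 where "th1 = \<phi> * l1 / l0"
  define th2 where "th2 = \<phi> * l2 / l1"
  define c where "c = \<phi> / (\<phi> - 1)"
  have th: "0 < th1" "0 < th2" using phi l by (auto simp: th1_def th2_def)
  have th2: "th2 \<le> 1 + 1 / \<phi>"
    using growth l phi by (simp add: th2_def power2_eq_square field_simps)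
  have phi0: "\<phi> \<noteq> 0" "\<phi> > 0" "\<phi> - 1 > 0" using phi by auto
  \<comment> \<open>Averaging eliminates \<open>v0\<close>; the factor \<phi> it produces, times
    \<open>l2 / l1\<close>, is \<open>th2\<close>.\<close>
  have v0_eq: "v0 - x1 = (- \<phi>) *\<^sub>R (x1 - v1)" using v1 by (simp add: algebra_simps)
  have "l2 / l1 * ((v0 - l1 *\<^sub>R f0 - x1) \<bullet> (x2 - x1)) \<le> l2 / l1 * (l1 * (h2 - h1))"
    using old l by (intro mult_left_mono) auto
  moreover have "(v0 - l1 *\<^sub>R f0 - x1) \<bullet> (x2 - x1)
      = - \<phi> * ((x1 - v1) \<bullet> (x2 - x1)) - l1 * (f0 \<bullet> (x2 - x1))"
  proof -
    have "v0 = x1 - \<phi> *\<^sub>R (x1 - v1)" using v0_eq by (simp add: algebra_simps)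
    then have "v0 - l1 *\<^sub>R f0 - x1 = (- \<phi>) *\<^sub>R (x1 - v1) - l1 *\<^sub>R f0" by simp
    then show ?thesis by (simp only: inner_diff_left inner_scaleR_left)
  qed
  moreover have "l2 / l1 * (- \<phi> * ((x1 - v1) \<bullet> (x2 - x1)) - l1 * (f0 \<bullet> (x2 - x1)))
     = - th2 * ((x1 - v1) \<bullet> (x2 - x1)) - l2 * (f0 \<bullet> (x2 - x1))"
    using l by (simp add: th2_def field_simps)
  ultimately have old': "- th2 * ((x1 - v1) \<bullet> (x2 - x1)) - l2 * (f0 \<bullet> (x2 - x1)) \<le> l2 * (h2 - h1)"
    using l by simp
  have new': "(v1 - x2) \<bullet> (p - x2) + l2 * (f1 \<bullet> (x1 - p)) + l2 * (f1 \<bullet> (x2 - x1)) \<le> l2 * (hp - h2)"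
    using new by (simp add: inner_diff_left inner_diff_right algebra_simps)
  have strong': "l2 * (\<beta> * (norm (x1 - p))\<^sup>2) \<le> l2 * (f1 \<bullet> (x1 - p) + h1 - hp)"
    using strong l by (intro mult_left_mono) auto
  have main: "2 * ((v1 - x2) \<bullet> (p - x2)) - th2 * (2 * ((x1 - v1) \<bullet> (x2 - x1)))
      + 2 * (l2 * ((f1 - f0) \<bullet> (x2 - x1))) + 2 * (l2 * \<beta> * (norm (x1 - p))\<^sup>2) \<le> 0"
    using old' new' strong' by (simp add: inner_diff_left algebra_simps)
  have i1: "2 * ((v1 - x2) \<bullet> (p - x2)) = (norm (x2 - v1))\<^sup>2 + (norm (x2 - p))\<^sup>2 - (norm (v1 - p))\<^sup>2"
    unfolding power2_norm_eq_inner by (simp add: inner_diff_left inner_diff_right inner_commute)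
  have i2: "2 * ((x1 - v1) \<bullet> (x2 - x1)) = (norm (x2 - v1))\<^sup>2 - (norm (x2 - x1))\<^sup>2 - (norm (x1 - v1))\<^sup>2"
    unfolding power2_norm_eq_inner by (simp add: inner_diff_left inner_diff_right inner_commute)
  \<comment> \<open>\<open>v2\<close> is the convex combination of \<open>x2\<close> and
    \<open>v1\<close> with weight \<open>1 / \<phi>\<close> on \<open>v1\<close>; the scaling
    \<open>c\<close> gives \<open>(norm (x2 - p))\<^sup>2\<close> coefficient 1.\<close>
  have i3: "c * (norm (v2 - p))\<^sup>2
      = (norm (x2 - p))\<^sup>2 + (c - 1) * (norm (v1 - p))\<^sup>2 - 1 / \<phi> * (norm (x2 - v1))\<^sup>2"
  proof -
    have "\<phi> *\<^sub>R (v2 - p) = \<phi> *\<^sub>R ((1 - 1 / \<phi>) *\<^sub>R (x2 - p) + (1 / \<phi>) *\<^sub>R (v1 - p))"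
      using phi0 v2 by (simp add: algebra_simps)
    then have "v2 - p = (1 - 1 / \<phi>) *\<^sub>R (x2 - p) + (1 / \<phi>) *\<^sub>R (v1 - p)"
      using phi0 by simp
    then have "(norm (v2 - p))\<^sup>2 = (1 - 1 / \<phi>) * (norm (x2 - p))\<^sup>2 + 1 / \<phi> * (norm (v1 - p))\<^sup>2
         - 1 / \<phi> * (1 - 1 / \<phi>) * (norm (x2 - v1))\<^sup>2"
      by (simp only: norm_convex_combination_sq) (simp add: norm_minus_commute)
    moreover have "c * (1 - 1 / \<phi>) = 1" "c * (1 / \<phi>) = c - 1"
      using phi0 by (auto simp: c_def field_simps)
    moreover have "c * (1 / \<phi> * (1 - 1 / \<phi>)) = 1 / \<phi>"
      using phi0 by (simp add: c_def field_simps)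
    ultimately show ?thesis
      by (simp only: right_diff_distrib[of c] distrib_left[of c] mult.assoc[symmetric])
  qed
  \<comment> \<open>Young's inequality in expanded form: \<open>curv\<close> bounds
    \<open>4 * l2\<^sup>2 * (norm (f1 - f0))\<^sup>2\<close> by
    \<open>th1 * th2 * (norm (x1 - x0))\<^sup>2\<close>, after which a common factor
    \<open>th2\<close> cancels.\<close>
  have cross: "- (th2 / 2 * (norm (x2 - x1))\<^sup>2 + th1 / 2 * (norm (x1 - x0))\<^sup>2)
      \<le> 2 * (l2 * ((f1 - f0) \<bullet> (x2 - x1)))"
  proof -
    have "0 \<le> (norm ((2 * l2) *\<^sub>R (f1 - f0) + th2 *\<^sub>R (x2 - x1)))\<^sup>2" by simp
    also have "\<dots> = l2 * (4 * l2 * (norm (f1 - f0))\<^sup>2) + 4 * l2 * th2 * ((f1 - f0) \<bullet> (x2 - x1))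
        + th2\<^sup>2 * (norm (x2 - x1))\<^sup>2"
      unfolding power2_norm_eq_inner
      by (simp add: inner_add_left inner_add_right inner_commute power2_eq_square)
    also have "4 * l2 * (norm (f1 - f0))\<^sup>2 \<le> \<phi>\<^sup>2 / l0 * (norm (x1 - x0))\<^sup>2"
      using curv l by (simp add: field_simps)
    then have "l2 * (4 * l2 * (norm (f1 - f0))\<^sup>2) \<le> l2 * (\<phi>\<^sup>2 / l0 * (norm (x1 - x0))\<^sup>2)"
      using l by (intro mult_left_mono) auto
    also have "l2 * (\<phi>\<^sup>2 / l0 * (norm (x1 - x0))\<^sup>2) = th1 * th2 * (norm (x1 - x0))\<^sup>2"
      using l by (simp add: th1_def th2_def power2_eq_square)
    finally have "0 \<le> th2 * (th1 * (norm (x1 - x0))\<^sup>2 + 4 * (l2 * ((f1 - f0) \<bullet> (x2 - x1)))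
        + th2 * (norm (x2 - x1))\<^sup>2)"
      by (simp add: algebra_simps power2_eq_square)
    then show ?thesis using th by (simp add: zero_le_mult_iff)
  qed
  have "(th2 - 1 - 1 / \<phi>) * (norm (x2 - v1))\<^sup>2 \<le> 0"
    using th2 by (intro mult_nonpos_nonneg) auto
  then have "c * (norm (v2 - p))\<^sup>2 + th2 / 2 * (norm (x2 - x1))\<^sup>2
       + (2 * (l2 * \<beta> * (norm (x1 - p))\<^sup>2) + th2 * (norm (x1 - v1))\<^sup>2)
      \<le> c * (norm (v1 - p))\<^sup>2 + th1 / 2 * (norm (x1 - x0))\<^sup>2"
    using main[unfolded i1 i2] cross unfolding i3 by (simp add: algebra_simps)
  then show ?thesis by (simp add: c_def th1_def th2_def mult.assoc)
qed

lemma strongly_monotone_imp_inj: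
  assumes "0 < \<beta>" "\<And>x y. \<beta> * (norm (x - y))\<^sup>2 \<le> (x - y) \<bullet> (F x - F y)"
  shows "inj F"
proof (rule injI)
  fix a b assume "F a = F b"
  then have "\<beta> * (norm (a - b))\<^sup>2 \<le> 0" using assms(2)[of a b] by simp
  then show "a = b" using assms(1) by (simp add: mult_le_0_iff)
qed

text \<open>The recursion reaches back two places, so positivity is carried for two consecutive
  indices. Injectivity of \<open>F\<close> keeps the denominator of the quotient nonzero.\<close>

lemma graal_stepsize_pos:
  fixes x :: "nat \<Rightarrow> 'a::real_normed_vector" and F :: "'a \<Rightarrow> 'b::real_normed_vector"
  assumes "1 < \<phi>" "0 < lmax" "0 < l 0" "0 < l 1" "inj F"
    and stepsize: "\<And>k. l (k + 2) =
       (if x (k + 2) = x (k + 1) then min ((1 / \<phi> + 1 / \<phi>\<^sup>2) * l (k + 1)) lmax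
        else min ((1 / \<phi> + 1 / \<phi>\<^sup>2) * l (k + 1))
          (min (\<phi>\<^sup>2 / (4 * l k) * ((norm (x (k + 2) - x (k + 1)))\<^sup>2 /
                 (norm (F (x (k + 2)) - F (x (k + 1))))\<^sup>2)) lmax))"
  shows "0 < l (k::nat)"
proof -
  have "0 < l k \<and> 0 < l (k + 1)"
  proof (induction k)
    case 0 then show ?case using assms by simp
  next
    case (Suc k)
    have "0 < (1 / \<phi> + 1 / \<phi>\<^sup>2) * l (k + 1)"
      using Suc assms(1) by (intro mult_pos_pos add_pos_pos) auto
    then show ?case using Suc stepsize[of k] assms(1,2) injD[OF assms(5)]
      by (auto intro!: mult_pos_pos divide_pos_pos)
  qed
  then show ?thesis by simp
qed

text \<open>The algorithm enters through real inequalities: \<open>update\<close> is the variational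
  form of the proximal step. The recursion is stated from index 2 on, so that no step size of index
  -1 occurs.\<close>

lemma graal_converges:
  fixes x xbar :: "nat \<Rightarrow> 'a::real_inner" and l :: "nat \<Rightarrow> real"
  assumes phi: "1 < \<phi>" "1 \<le> 1 / \<phi> + 1 / \<phi>\<^sup>2" and \<beta>: "0 < \<beta>" and lmax: "0 < lmax"
    and l_pos: "\<And>k. 0 < l k" and l1: "l 1 \<le> lmax"
    and mono: "\<And>x y. \<beta> * (norm (x - y))\<^sup>2 \<le> (x - y) \<bullet> (F x - F y)"
    and lip: "\<And>z r. \<exists>L. L-lipschitz_on (cball z r) F"
    and p: "p \<in> D" "\<And>y. y \<in> D \<Longrightarrow> h p \<le> h y + F p \<bullet> (y - p)"
    and stepsize: "\<And>k. l (k + 2) =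
       (if x (k + 2) = x (k + 1) then min ((1 / \<phi> + 1 / \<phi>\<^sup>2) * l (k + 1)) lmax
        else min ((1 / \<phi> + 1 / \<phi>\<^sup>2) * l (k + 1))
          (min (\<phi>\<^sup>2 / (4 * l k) * ((norm (x (k + 2) - x (k + 1)))\<^sup>2 /
                 (norm (F (x (k + 2)) - F (x (k + 1))))\<^sup>2)) lmax))"
    and averaging: "\<And>k. \<phi> *\<^sub>R xbar (k + 1) = (\<phi> - 1) *\<^sub>R x (k + 1) + xbar k"
    and x_dom: "\<And>k. x (k + 2) \<in> D"
    and update: "\<And>k y. y \<in> D \<Longrightarrow>
       (xbar (k + 1) - l (k + 1) *\<^sub>R F (x (k + 1)) - x (k + 2)) \<bullet> (y - x (k + 2))
         \<le> l (k + 1) * (h y - h (x (k + 2)))"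
  shows "x \<longlonglongrightarrow> p" and "xbar \<longlonglongrightarrow> p"
proof -

  \<comment> \<open>Consequences of the step size rule and of strong monotonicity\<close>
  have F_inj: "F a \<noteq> F b" if "a \<noteq> b" for a b
    using strongly_monotone_imp_inj[OF \<beta> mono] that by (blast dest: injD)
  have l_max: "l (k + 1) \<le> lmax" for k
    by (cases k) (use l1 stepsize in auto)
  have growth: "l (k + 2) \<le> (1 / \<phi> + 1 / \<phi>\<^sup>2) * l (k + 1)" for k
    using stepsize[of k] by auto
  have curv: "4 * l (k + 2) * l k * (norm (F (x (k + 2)) - F (x (k + 1))))\<^sup>2
       \<le> \<phi>\<^sup>2 * (norm (x (k + 2) - x (k + 1)))\<^sup>2" for k
  proof (cases "x (k + 2) = x (k + 1)")
    case False
    let ?n = "(norm (F (x (k + 2)) - F (x (k + 1))))\<^sup>2"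
    have n: "0 < ?n" using F_inj[OF False] by simp
    have "l (k + 2) \<le> \<phi>\<^sup>2 / (4 * l k) * ((norm (x (k + 2) - x (k + 1)))\<^sup>2 / ?n)"
      unfolding stepsize[of k] using False by simp
    also have "\<dots> = \<phi>\<^sup>2 * (norm (x (k + 2) - x (k + 1)))\<^sup>2 / (4 * l k * ?n)" by simp
    finally have "l (k + 2) * (4 * l k * ?n) \<le> \<phi>\<^sup>2 * (norm (x (k + 2) - x (k + 1)))\<^sup>2"
      using n l_pos[of k] by (subst (asm) pos_le_divide_eq) auto
    then show ?thesis by (simp add: ac_simps)
  qed simp
  have strong: "\<beta> * (norm (x (k + 2) - p))\<^sup>2 \<le> F (x (k + 2)) \<bullet> (x (k + 2) - p) + h (x (k + 2)) - h p" for k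
    using mono[of "x (k + 2)" p] p(2)[OF x_dom[of k]]
    by (simp add: inner_diff_right inner_diff_left inner_commute)

  \<comment> \<open>Energy decrease and boundedness of the iterates\<close>
  define c where "c = \<phi> / (\<phi> - 1)"
  have c: "1 \<le> c" using phi by (simp add: c_def field_simps)
  define E where "E k = c * (norm (xbar (k + 2) - p))\<^sup>2
     + \<phi> * l (k + 1) / l k / 2 * (norm (x (k + 2) - x (k + 1)))\<^sup>2" for k
  define a where "a k = 2 * l (k + 2) * \<beta> * (norm (x (k + 2) - p))\<^sup>2
     + \<phi> * l (k + 2) / l (k + 1) * (norm (x (k + 2) - xbar (k + 2)))\<^sup>2" for k
  have decr: "E (Suc k) + a k \<le> E k" for k
  proof -
    have avg: "\<phi> *\<^sub>R xbar (k + 2) = (\<phi> - 1) *\<^sub>R x (k + 2) + xbar (k + 1)"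
      "\<phi> *\<^sub>R xbar (k + 3) = (\<phi> - 1) *\<^sub>R x (k + 3) + xbar (k + 2)"
      using averaging[of "k + 1"] averaging[of "k + 2"] by (simp_all add: numeral_eq_Suc)
    have new: "(xbar (k + 2) - l (k + 2) *\<^sub>R F (x (k + 2)) - x (k + 3)) \<bullet> (p - x (k + 3))
       \<le> l (k + 2) * (h p - h (x (k + 3)))"
      using update[OF p(1), of "k + 1"] by (simp add: numeral_eq_Suc)
    have "x (k + 3) \<in> D" using x_dom[of "k + 1"] by (simp add: numeral_eq_Suc)
    note old = update[OF this, of k]
    show ?thesis
      using graal_energy_step[OF phi(1) l_pos[of k] l_pos[of "k + 1"] l_pos[of "k + 2"] avg new old
          strong[of k] growth[of k] curv[of k]]
      by (simp add: E_def a_def c_def numeral_eq_Suc)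
  qed
  have E_nonneg: "0 \<le> E k" for k
    using c phi l_pos[of k] l_pos[of "k + 1"] by (simp add: E_def)
  have a_nonneg: "0 \<le> a k" for k
    using \<beta> phi l_pos[of "k + 1"] l_pos[of "k + 2"] by (simp add: a_def)
  have a_lim: "a \<longlonglongrightarrow> 0"
    by (rule telescoping_decrease_tendsto_0[of E]) (rule E_nonneg a_nonneg decr)+
  have E_0: "E k \<le> E 0" for k
  proof (induction k)
    case (Suc k) then show ?case using decr[of k] a_nonneg[of k] by linarith
  qed simp
  define r where "r = sqrt (E 0)"
  have xbar_bd: "norm (xbar (k + 2) - p) \<le> r" for k
  proof -
    have "0 \<le> \<phi> * l (k + 1) / l k / 2 * (norm (x (k + 2) - x (k + 1)))\<^sup>2"
      using phi l_pos[of k] l_pos[of "k + 1"] by simp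
    moreover have "(norm (xbar (k + 2) - p))\<^sup>2 \<le> c * (norm (xbar (k + 2) - p))\<^sup>2"
      using c mult_right_mono[of 1 c] by simp
    ultimately have "(norm (xbar (k + 2) - p))\<^sup>2 \<le> E 0" using E_0[of k] by (simp add: E_def)
    then show ?thesis unfolding r_def by (rule real_le_rsqrt)
  qed
  \<comment> \<open>Solving the averaging rule for \<open>x\<close> expresses it by two consecutive
    averages, both within \<open>r\<close> of \<open>p\<close>.\<close>
  define R where "R = (\<phi> + 1) * r / (\<phi> - 1)"
  have x_bd: "norm (x (k + 3) - p) \<le> R" for k
  proof -
    have "(\<phi> - 1) *\<^sub>R (x (k + 3) - p) = \<phi> *\<^sub>R (xbar (k + 3) - p) - (xbar (k + 2) - p)"
      using averaging[of "k + 2"] by (simp add: algebra_simps numeral_3_eq_3)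
    then have "(\<phi> - 1) * norm (x (k + 3) - p) = norm (\<phi> *\<^sub>R (xbar (k + 3) - p) - (xbar (k + 2) - p))"
      using phi by (metis abs_of_pos diff_gt_0_iff_gt norm_scaleR)
    also have "\<dots> \<le> \<phi> * norm (xbar (k + 3) - p) + norm (xbar (k + 2) - p)"
      using norm_triangle_ineq4[of "\<phi> *\<^sub>R (xbar (k + 3) - p)" "xbar (k + 2) - p"] phi by simp
    also have "\<dots> \<le> \<phi> * r + r"
      using xbar_bd[of k] xbar_bd[of "k + 1"] phi
      by (intro add_mono mult_left_mono) (auto simp: numeral_3_eq_3)
    finally show ?thesis using phi by (simp add: R_def field_simps)
  qed

  \<comment> \<open>Lower bound for the step sizes\<close>
  obtain L0 where L0: "L0-lipschitz_on (cball p R) F" using lip by blast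
  define L where "L = max L0 1"
  have L: "0 < L" "L-lipschitz_on (cball p R) F"
    using L0 by (auto simp: L_def intro: lipschitz_on_le)
  \<comment> \<open>A lower bound for the quotient term, from the Lipschitz constant
    \<open>L\<close> and \<open>l \<le> lmax\<close>. It is available from \<open>l 4\<close> on,
    because \<open>x_bd\<close> starts at \<open>x 3\<close>; hence \<open>l 3\<close> enters
    \<open>m\<close> separately.\<close>
  define b where "b = \<phi>\<^sup>2 / (4 * lmax * L\<^sup>2)"
  have b: "0 < b" using phi lmax L by (simp add: b_def)
  define m where "m = min (l 3) (min b lmax)"
  have m: "0 < m" using l_pos b lmax by (simp add: m_def)
  have l_low: "m \<le> l (k + 3)" for k
  proof (induction k)
    case 0 then show ?case by (simp add: m_def)
  next
    case (Suc k)
    \<comment> \<open>Here \<phi> being at most the golden ratio matters: the growth factor is at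
      least 1, so this term of the minimum cannot shrink the step sizes.\<close>
    have "1 * l (k + 3) \<le> (1 / \<phi> + 1 / \<phi>\<^sup>2) * l (k + 3)"
      using phi l_pos[of "k + 3"] by (intro mult_right_mono) auto
    then have g: "m \<le> (1 / \<phi> + 1 / \<phi>\<^sup>2) * l (k + 3)" using Suc by simp
    have "b \<le> \<phi>\<^sup>2 / (4 * l (k + 2)) * ((norm (x (k + 4) - x (k + 3)))\<^sup>2 /
                 (norm (F (x (k + 4)) - F (x (k + 3))))\<^sup>2)" if ne: "x (k + 4) \<noteq> x (k + 3)"
    proof -
      let ?d = "norm (x (k + 4) - x (k + 3))" and ?n = "norm (F (x (k + 4)) - F (x (k + 3)))"
      have n: "0 < ?n" using F_inj[OF ne] by simp
      have "?n \<le> L * ?d"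
        using lipschitz_onD[OF L(2), of "x (k + 4)" "x (k + 3)"] x_bd[of k] x_bd[of "k + 1"]
        by (simp add: dist_norm norm_minus_commute numeral_eq_Suc)
      then have "?n\<^sup>2 \<le> L\<^sup>2 * ?d\<^sup>2" using n by (metis norm_ge_zero power_mono power_mult_distrib)
      then have "1 / L\<^sup>2 \<le> ?d\<^sup>2 / ?n\<^sup>2" using n L(1) by (simp add: field_simps)
      moreover have "\<phi>\<^sup>2 / (4 * lmax) \<le> \<phi>\<^sup>2 / (4 * l (k + 2))"
        using l_pos[of "k + 2"] l_max[of "k + 1"] lmax by (intro divide_left_mono) auto
      ultimately have "\<phi>\<^sup>2 / (4 * lmax) * (1 / L\<^sup>2) \<le> \<phi>\<^sup>2 / (4 * l (k + 2)) * (?d\<^sup>2 / ?n\<^sup>2)"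
        using l_pos[of "k + 2"] by (intro mult_mono) auto
      then show ?thesis by (simp add: b_def)
    qed
    then show ?case using g stepsize[of "k + 2"] by (auto simp: m_def numeral_eq_Suc min_le_iff_disj)
  qed

  \<comment> \<open>Limits from the vanishing energy drop\<close>
  have sq_lim: "(\<lambda>k. X (k + 4)) \<longlonglongrightarrow> 0" if "0 < w" "\<And>k. w * (norm (X (k + 4)))\<^sup>2 \<le> a (k + 2)"
    for w and X :: "nat \<Rightarrow> 'a"
  proof -
    have "(\<lambda>k. a (k + 2) / w) \<longlonglongrightarrow> 0 / w"
      using tendsto_divide[OF LIMSEQ_ignore_initial_segment[OF a_lim, of 2] tendsto_const[of w]] that(1)
      by simp
    from tendsto_real_sqrt[OF this] have "(\<lambda>k. sqrt (a (k + 2) / w)) \<longlonglongrightarrow> 0" by simp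
    moreover have "norm (X (k + 4)) \<le> sqrt (a (k + 2) / w)" for k
      using that by (intro real_le_rsqrt) (simp add: pos_le_divide_eq mult.commute)
    ultimately show ?thesis
      by (intro Lim_null_comparison[of "\<lambda>k. X (k + 4)" "\<lambda>k. sqrt (a (k + 2) / w)"]) auto
  qed
  have "(\<lambda>k. x (k + 4) - p) \<longlonglongrightarrow> 0"
  proof (rule sq_lim[of "2 * m * \<beta>" "\<lambda>k. x k - p"])
    fix k
    have "2 * m * \<beta> * (norm (x (k + 4) - p))\<^sup>2 \<le> 2 * l (k + 4) * \<beta> * (norm (x (k + 4) - p))\<^sup>2"
      using l_low[of "k + 1"] \<beta> by (intro mult_right_mono mult_left_mono) (auto simp: numeral_eq_Suc)
    also have "\<dots> \<le> a (k + 2)"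
      using phi l_pos[of "k + 3"] l_pos[of "k + 4"] by (simp add: a_def numeral_eq_Suc)
    finally show "2 * m * \<beta> * (norm (x (k + 4) - p))\<^sup>2 \<le> a (k + 2)" .
  qed (use m \<beta> in auto)
  then have "(\<lambda>k. x (k + 4)) \<longlonglongrightarrow> p" by (rule LIM_zero_cancel)
  then show x_lim: "x \<longlonglongrightarrow> p" by (rule LIMSEQ_offset)
  have "(\<lambda>k. x (k + 4) - xbar (k + 4)) \<longlonglongrightarrow> 0"
  proof (rule sq_lim[of "\<phi> * m / lmax" "\<lambda>k. x k - xbar k"])
    fix k
    have "\<phi> * m / lmax \<le> \<phi> * l (k + 4) / l (k + 3)"
      using l_low[of "k + 1"] l_max[of "k + 2"] l_pos[of "k + 3"] phi m
      by (intro frac_le mult_left_mono mult_nonneg_nonneg) (auto simp: numeral_eq_Suc)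
    then have "\<phi> * m / lmax * (norm (x (k + 4) - xbar (k + 4)))\<^sup>2
        \<le> \<phi> * l (k + 4) / l (k + 3) * (norm (x (k + 4) - xbar (k + 4)))\<^sup>2"
      by (rule mult_right_mono) simp
    also have "\<dots> \<le> a (k + 2)"
      using \<beta> l_pos[of "k + 4"] by (simp add: a_def numeral_eq_Suc)
    finally show "\<phi> * m / lmax * (norm (x (k + 4) - xbar (k + 4)))\<^sup>2 \<le> a (k + 2)" .
  qed (use m phi lmax in auto)
  then have "(\<lambda>k. x k - xbar k) \<longlonglongrightarrow> 0"
    by (rule LIMSEQ_offset[of "\<lambda>k. x k - xbar k" 4])
  from tendsto_diff[OF x_lim this] show "xbar \<longlonglongrightarrow> p" by simp
qed

section \<open>Subdifferentials and proximal points of extended-valued functions\<close>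

lemma proper_edom_eq: "proper g \<Longrightarrow> x \<in> edom g \<Longrightarrow> g x = ereal (real_of_ereal (g x))"
  by (cases "g x") (auto simp: proper_def edom_def)

lemma not_edom_eq: "x \<notin> edom g \<Longrightarrow> g x = \<infinity>"
  by (simp add: edom_def)

text \<open>If \<open>r < c < g x\<close>, then \<open>g\<close> exceeds \<open>c\<close> on a
  neighbourhood \<open>U\<close> of \<open>x\<close>, and \<open>U \<times> {..<c}\<close> misses
  the epigraph.\<close>

lemma lower_semicontinuous_closed_epigraph:
  assumes "proper g" "lower_semicontinuous g"
  shows "closed (epigraph (edom g) (\<lambda>x. real_of_ereal (g x)))"
proof -
  have mem: "(x, r) \<in> epigraph (edom g) (\<lambda>x. real_of_ereal (g x)) \<longleftrightarrow> g x \<le> ereal r" for x r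
    using assms(1) by (cases "g x") (auto simp: mem_epigraph edom_def proper_def)
  have "open (- epigraph (edom g) (\<lambda>x. real_of_ereal (g x)))"
  proof (rule open_prod_intro)
    fix z assume "z \<in> - epigraph (edom g) (\<lambda>x. real_of_ereal (g x))"
    then obtain x r where z: "z = (x, r)" and "ereal r < g x"
      using mem by (cases z) (auto simp: not_le)
    then obtain c where c: "r < c" "ereal c < g x" using ereal_dense2 by force
    have "g x \<le> Liminf (at x) g" using assms(2) by (simp add: lower_semicontinuous_def)
    then have "\<forall>\<^sub>F y in at x. ereal c < g y" using c(2) le_Liminf_iff by blast
    then have "\<forall>\<^sub>F y in nhds x. ereal c < g y"
      using c(2) by (auto simp: eventually_at_filter elim: eventually_mono)
    then obtain U where U: "open U" "x \<in> U" "\<And>y. y \<in> U \<Longrightarrow> ereal c < g y"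
      unfolding eventually_nhds by blast
    have "U \<times> {..<c} \<subseteq> - epigraph (edom g) (\<lambda>x. real_of_ereal (g x))"
    proof
      fix w assume "w \<in> U \<times> {..<c}"
      then obtain y t where w: "w = (y, t)" "y \<in> U" "t < c" by blast
      then have "ereal t < ereal c" "ereal c < g y" using U(3) by auto
      then have "ereal t < g y" by (rule less_trans)
      then show "w \<in> - epigraph (edom g) (\<lambda>x. real_of_ereal (g x))" by (simp add: w mem not_le)
    qed
    then show "\<exists>A B. open A \<and> open B \<and> z \<in> A \<times> B
        \<and> A \<times> B \<subseteq> - epigraph (edom g) (\<lambda>x. real_of_ereal (g x))"
      using U(1,2) c(1) z by (intro exI[of _ U] exI[of _ "{..<c}"]) auto
  qed
  then show ?thesis by (simp add: closed_def)
qed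

text \<open>\<open>ineq\<close> leaves the value at the intermediate point extended, so that its
  finiteness, hence convexity of the domain, and the real inequality both follow from it.\<close>

lemma alpha_convex_modulus_convex_on:
  fixes g :: "'a::real_inner \<Rightarrow> ereal"
  assumes "proper g" "alpha_convex \<alpha> g"
  shows "modulus_convex_on \<alpha> (edom g) (\<lambda>x. real_of_ereal (g x))"
proof -
  define G where "G x = real_of_ereal (g x)" for x
  have G: "g x = ereal (G x)" if "x \<in> edom g" for x
    using proper_edom_eq[OF assms(1) that] by (simp add: G_def)
  have ineq: "g ((1 - t) *\<^sub>R x + t *\<^sub>R y)
      \<le> ereal ((1 - t) * (G x - \<alpha> / 2 * (norm x)\<^sup>2) + t * (G y - \<alpha> / 2 * (norm y)\<^sup>2)
          + \<alpha> / 2 * (norm ((1 - t) *\<^sub>R x + t *\<^sub>R y))\<^sup>2)"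
    if "x \<in> edom g" "y \<in> edom g" "0 < t" "t < 1" for x y t
  proof -
    have "g ((1 - t) *\<^sub>R x + t *\<^sub>R y) - ereal (\<alpha> / 2 * (norm ((1 - t) *\<^sub>R x + t *\<^sub>R y))\<^sup>2)
      \<le> ereal (1 - t) * (g x - ereal (\<alpha> / 2 * (norm x)\<^sup>2)) + ereal t * (g y - ereal (\<alpha> / 2 * (norm y)\<^sup>2))"
      using assms(2) that unfolding alpha_convex_def econvex_def by blast
    then show ?thesis
      using that G by (cases "g ((1 - t) *\<^sub>R x + t *\<^sub>R y)") auto
  qed
  have "convex (edom g)"
    unfolding convex_alt
  proof (intro ballI allI impI)
    fix x y and t :: real assume *: "x \<in> edom g" "y \<in> edom g" "0 \<le> t \<and> t \<le> 1"
    show "(1 - t) *\<^sub>R x + t *\<^sub>R y \<in> edom g"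
    proof (cases "t = 0 \<or> t = 1")
      case False
      then show ?thesis using ineq[of x y t] * by (cases "g ((1 - t) *\<^sub>R x + t *\<^sub>R y)") (auto simp: edom_def)
    qed (use * in auto)
  qed
  moreover have "G ((1 - t) *\<^sub>R x + t *\<^sub>R y) - \<alpha> / 2 * (norm ((1 - t) *\<^sub>R x + t *\<^sub>R y))\<^sup>2
      \<le> (1 - t) * (G x - \<alpha> / 2 * (norm x)\<^sup>2) + t * (G y - \<alpha> / 2 * (norm y)\<^sup>2)"
    if "x \<in> edom g" "y \<in> edom g" "0 < t" "t < 1" for x y t
  proof -
    have "(1 - t) *\<^sub>R x + t *\<^sub>R y \<in> edom g"
      using \<open>convex (edom g)\<close> that by (auto simp: convex_alt)
    then show ?thesis using ineq[OF that] by (simp add: G)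
  qed
  ultimately show ?thesis
    unfolding modulus_convex_on_def G_def[symmetric] by (intro convex_onI) auto
qed

text \<open>Convexity up to a quadratic makes the local condition global: apply it on the segment
  from \<open>z\<close> to \<open>y\<close> and let the weight tend to 0. Conversely, the quadratic
  remainder divided by the distance vanishes at \<open>z\<close>, and the quotient is infinite off
  the domain.\<close>

lemma frechet_subdifferential_iff:
  fixes g :: "'a::real_inner \<Rightarrow> ereal"
  assumes "proper g" "alpha_convex \<alpha> g" and z: "z \<in> edom g"
  shows "u \<in> frechet_subdifferential g z \<longleftrightarrow>
     (\<forall>y\<in>edom g. real_of_ereal (g z) + u \<bullet> (y - z) + \<alpha> / 2 * (norm (y - z))\<^sup>2 \<le> real_of_ereal (g y))"
proof -
  define G where "G x = real_of_ereal (g x)" for x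
  have G: "g x = ereal (G x)" if "x \<in> edom g" for x
    using proper_edom_eq[OF assms(1) that] by (simp add: G_def)
  have sc: "modulus_convex_on \<alpha> (edom g) G"
    using alpha_convex_modulus_convex_on[OF assms(1,2)] by (simp add: G_def[abs_def])
  define Q where "Q y = (g y - g z - ereal (u \<bullet> (y - z))) / ereal (norm (y - z))" for y
  have Q: "Q y = ereal ((G y - G z - u \<bullet> (y - z)) / norm (y - z))" if "y \<in> edom g" "y \<noteq> z" for y
    using that z by (simp add: Q_def G)
  have Q_inf: "Q y = \<infinity>" if "y \<notin> edom g" for y
    using that z by (auto simp: Q_def G not_edom_eq ereal_divide_eq)
  have mem: "u \<in> frechet_subdifferential g z \<longleftrightarrow> (\<forall>c<0. \<forall>\<^sub>F y in at z. c < Q y)"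
    using z by (simp add: frechet_subdifferential_def Q_def[abs_def] le_Liminf_iff)
  show ?thesis
    unfolding mem G_def[symmetric]
  proof (intro iffI ballI allI impI)
    fix y assume lim: "\<forall>c<0. \<forall>\<^sub>F y in at z. c < Q y" and y: "y \<in> edom g"
    show "G z + u \<bullet> (y - z) + \<alpha> / 2 * (norm (y - z))\<^sup>2 \<le> G y"
    proof (cases "y = z")
      case False
      define s where "s = norm (y - z)"
      have s: "0 < s" using False by (simp add: s_def)
      show ?thesis
      proof (rule field_le_epsilon)
        fix e :: real assume e: "0 < e"
        \<comment> \<open>Multiplied by the distance \<open>t * s\<close> from \<open>z\<close>,
          this slope costs exactly \<open>t * e\<close>.\<close>
        define c where "c = - (e / s)"
        have "ereal c < 0" using e s by (simp add: c_def)
        with lim have "\<forall>\<^sub>F y in at z. ereal c < Q y" by blast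
        then obtain d where d: "0 < d" "\<And>y. y \<noteq> z \<Longrightarrow> dist y z < d \<Longrightarrow> ereal c < Q y"
          unfolding eventually_at by blast
        have "\<forall>\<^sub>F t in at_right 0. u \<bullet> (y - z) + \<alpha> / 2 * (1 - t) * s\<^sup>2 - e \<le> G y - G z"
          unfolding eventually_at_right_field
        proof (intro exI[of _ "min 1 (d / s)"] conjI allI impI)
          fix t :: real assume "0 < t" "t < min 1 (d / s)"
          then have t: "0 < t" "t < 1" "t * s < d" using s by (auto simp: field_simps)
          define w where "w = (1 - t) *\<^sub>R z + t *\<^sub>R y"
          have w: "w - z = t *\<^sub>R (y - z)" by (simp add: w_def algebra_simps)
          have "w \<in> edom g"
            using modulus_convex_on_imp_convex[OF sc] y z t by (auto simp: convex_alt w_def)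
          moreover have wz: "norm (w - z) = t * s" using t by (simp add: w s_def)
          moreover have "w \<noteq> z" using wz t s by auto
          ultimately have "c < (G w - G z - t * (u \<bullet> (y - z))) / (t * s)"
            using d(2)[of w] Q[of w] t by (simp add: dist_norm w)
          then have "c * (t * s) < G w - G z - t * (u \<bullet> (y - z))"
            using t s by (simp add: pos_less_divide_eq)
          moreover have "G w \<le> (1 - t) * G z + t * G y - \<alpha> / 2 * (t * (1 - t)) * s\<^sup>2"
            unfolding w_def s_def using modulus_convex_onD[OF sc, of t z y] t y z by simp
          moreover have "c * (t * s) = - (t * e)" using s by (simp add: c_def)
          ultimately have "t * (u \<bullet> (y - z) + \<alpha> / 2 * (1 - t) * s\<^sup>2 - e) \<le> t * (G y - G z)"
            by (simp add: algebra_simps)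
          then show "u \<bullet> (y - z) + \<alpha> / 2 * (1 - t) * s\<^sup>2 - e \<le> G y - G z"
            using t mult_le_cancel_left_pos by blast
        qed (use d s in auto)
        moreover have "((\<lambda>t. u \<bullet> (y - z) + \<alpha> / 2 * (1 - t) * s\<^sup>2 - e) \<longlongrightarrow>
            u \<bullet> (y - z) + \<alpha> / 2 * (1 - 0) * s\<^sup>2 - e) (at_right (0::real))"
          by (intro tendsto_intros)
        ultimately have "u \<bullet> (y - z) + \<alpha> / 2 * (1 - 0) * s\<^sup>2 - e \<le> G y - G z"
          by (intro tendsto_upperbound) auto
        then show "G z + u \<bullet> (y - z) + \<alpha> / 2 * (norm (y - z))\<^sup>2 \<le> G y + e"
          by (simp add: s_def)
      qed
    qed simp
  next
    fix c :: ereal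
    assume sub: "\<forall>y\<in>edom g. G z + u \<bullet> (y - z) + \<alpha> / 2 * (norm (y - z))\<^sup>2 \<le> G y" and "c < 0"
    then obtain r where r: "c < ereal r" "r < 0" using ereal_dense2[of c 0] by auto
    \<comment> \<open>Within this radius the remainder \<open>\<alpha> / 2 * s\<close> stays above
      \<open>r\<close>; the summand 1 keeps the denominator positive for
      \<open>\<alpha> = 0\<close>.\<close>
    define d where "d = - r / (\<bar>\<alpha>\<bar> / 2 + 1)"
    have d: "0 < d" unfolding d_def using r by (intro divide_pos_pos) auto
    have "ereal r < Q y" if y: "y \<noteq> z" "dist y z < d" for y
    proof (cases "y \<in> edom g")
      case True
      define s where "s = norm (y - z)"
      have s: "0 < s" "s < d" using y by (auto simp: s_def dist_norm)
      have "s * (\<bar>\<alpha>\<bar> / 2 + 1) < d * (\<bar>\<alpha>\<bar> / 2 + 1)" using s(2) by (intro mult_strict_right_mono) auto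
      also have "\<dots> = - r" unfolding d_def by (simp add: add_pos_nonneg[THEN less_imp_neq, symmetric])
      finally have "s * (\<bar>\<alpha>\<bar> / 2 + 1) < - r" .
      moreover have "\<bar>\<alpha>\<bar> / 2 * s + \<alpha> / 2 * s \<ge> 0"
        using s mult_right_mono[of 0 "\<bar>\<alpha>\<bar> / 2 + \<alpha> / 2" s] by (simp add: distrib_right)
      ultimately have "r < \<alpha> / 2 * s" using s by (simp add: algebra_simps)
      moreover have "\<alpha> / 2 * s * s \<le> G y - G z - u \<bullet> (y - z)"
        using sub True by (force simp: s_def power2_eq_square)
      then have "\<alpha> / 2 * s \<le> (G y - G z - u \<bullet> (y - z)) / s"
        using s by (simp add: pos_le_divide_eq)
      ultimately have "r < (G y - G z - u \<bullet> (y - z)) / s" by linarith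
      then show ?thesis using Q[OF True y(1)] by (simp only: s_def less_ereal.simps)
    qed (simp add: Q_inf)
    then have "\<forall>\<^sub>F y in at z. ereal r < Q y" using d unfolding eventually_at by blast
    then show "\<forall>\<^sub>F y in at z. c < Q y" by (rule eventually_mono) (use r(1) in \<open>auto intro: less_trans\<close>)
  qed
qed

text \<open>The condition \<open>0 < \<alpha> + 1 / c\<close> makes the proximal objective strongly
  convex even for negative \<alpha>, which gives existence and uniqueness.\<close>

lemma prox_singleton:
  fixes g :: "'a::{real_inner,complete_space} \<Rightarrow> ereal"
  assumes g: "proper g" "lower_semicontinuous g" "alpha_convex \<alpha> g" and c: "0 < c" "0 < \<alpha> + 1 / c"
  obtains p where "prox c g x = {p}" "p \<in> edom g"
    "\<And>y. y \<in> edom g \<Longrightarrow> (x - p) \<bullet> (y - p) + c * \<alpha> / 2 * (norm (y - p))\<^sup>2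
        \<le> c * (real_of_ereal (g y) - real_of_ereal (g p))"
proof -
  define G where "G x = real_of_ereal (g x)" for x
  have G: "g x = ereal (G x)" if "x \<in> edom g" for x
    using proper_edom_eq[OF g(1) that] by (simp add: G_def)
  have sc: "modulus_convex_on \<alpha> (edom g) G"
    using alpha_convex_modulus_convex_on[OF g(1,3)] by (simp add: G_def[abs_def])
  define H where "H u = G u + 1 / c / 2 * (norm (u - x))\<^sup>2" for u
  have scH: "modulus_convex_on (\<alpha> + 1 / c) (edom g) H"
    unfolding H_def[abs_def] by (rule modulus_convex_on_add_quadratic[OF sc])
  have "closed (epigraph (edom g) H)"
    unfolding H_def G_def
    by (intro closed_epigraph_add lower_semicontinuous_closed_epigraph g continuous_intros)
  then obtain p where p: "p \<in> edom g" "\<And>y. y \<in> edom g \<Longrightarrow> H p \<le> H y"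
    using strongly_convex_minimizer_exists[OF scH c(2)] g(1) by (auto simp: proper_def)
  have objective: "g u + ereal (1 / (2 * c) * (norm (x - u))\<^sup>2) = (if u \<in> edom g then ereal (H u) else \<infinity>)" for u
    by (simp add: G H_def not_edom_eq norm_minus_commute)
  have "u = p" if "u \<in> prox c g x" for u
  proof -
    from that have le: "(if u \<in> edom g then ereal (H u) else \<infinity>) \<le> (if y \<in> edom g then ereal (H y) else \<infinity>)" for y
      by (simp only: prox_def is_arg_min_linorder objective) simp
    have u: "u \<in> edom g" "H u \<le> H p" using le[of p] p(1) by (auto split: if_splits)
    then have "(\<alpha> + 1 / c) / 2 * (norm (u - p))\<^sup>2 \<le> 0"
      using modulus_convex_on_minimizer_growth[OF scH p(1) p(2) u(1)] by linarith
    then show ?thesis using c(2) by (simp add: mult_le_0_iff)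
  qed
  moreover have "p \<in> prox c g x"
    using p by (simp only: prox_def is_arg_min_linorder objective) simp
  ultimately have "prox c g x = {p}" by blast
  then show thesis
    using that[OF _ p(1)] proximal_inequality[OF sc c(1) p(1), of x] p(2) by (simp add: H_def G_def)
qed

section \<open>Convergence to the resolvent\<close>

theorem theorem4:
  fixes g :: "'a::{real_inner, complete_space} \<Rightarrow> ereal"
    and B :: "'a \<Rightarrow> 'a"
    and q :: 'a
    and \<alpha>A \<alpha>B \<theta> \<sigma>A \<sigma>B \<gamma>bar \<phi> \<rho> :: real
    and x xbar :: "nat \<Rightarrow> 'a"
    and \<gamma> :: "int \<Rightarrow> real"
  assumes finite_dim: "\<exists>S::'a set. finite S \<and> span S = UNIV"
    and "proper g" and "lower_semicontinuous g" and "alpha_convex \<alpha>A g"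
    and "alpha_monotone \<alpha>B B" and "locally_lipschitz B"
    and "\<theta> > 0" and "\<sigma>A > 0" and "\<sigma>B > 0"
    and "\<theta> * \<alpha>A + \<sigma>A > 0" and "\<theta> * \<alpha>B + \<sigma>B > 0"
    and "\<gamma> 0 > 0" and "\<gamma>bar > 0"
    and "1 < \<phi>" and "\<phi> \<le> (1 + sqrt 5) / 2"
    and "xbar 0 = x 1" and "\<gamma> (-1) = \<phi> * \<gamma> 0" and "\<rho> = 1 / \<phi> + 1 / \<phi>\<^sup>2"
    and stepsize: "\<And>k::nat. k \<ge> 1 \<Longrightarrow>
      \<gamma> (int k) =
        (if x k = x (k - 1) then min (\<rho> * \<gamma> (int k - 1)) \<gamma>bar
         else min (\<rho> * \<gamma> (int k - 1))
               (min (\<phi>\<^sup>2 / (4 * \<gamma> (int k - 2)) *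
                      ((norm (x k - x (k - 1)))\<^sup>2 /
                       (norm (\<theta> *\<^sub>R (B (x k) - B (x (k - 1))) + \<sigma>B *\<^sub>R (x k - x (k - 1))))\<^sup>2))
                    \<gamma>bar))"
    and averaging: "\<And>k::nat. k \<ge> 1 \<Longrightarrow>
      xbar k = (1 / \<phi>) *\<^sub>R ((\<phi> - 1) *\<^sub>R x k + xbar (k - 1))"
    and update: "\<And>k::nat. k \<ge> 1 \<Longrightarrow>
      x (k + 1) = the_elem (prox (\<gamma> (int k) * \<theta> / (1 + \<gamma> (int k) * \<sigma>A)) g
        ((1 / (1 + \<gamma> (int k) * \<sigma>A)) *\<^sub>R
          (xbar k - (\<gamma> (int k) * \<sigma>B) *\<^sub>R x k - (\<gamma> (int k) * \<theta>) *\<^sub>R B (x k)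
             + (\<gamma> (int k) * (\<sigma>A + \<sigma>B)) *\<^sub>R q)))"
  shows "\<exists>p. resolvent (\<theta> / (\<sigma>A + \<sigma>B)) (\<lambda>z. (\<lambda>u. u + B z) ` frechet_subdifferential g z) q = {p} \<and>
             x \<longlonglongrightarrow> p \<and> xbar \<longlonglongrightarrow> p"
proof -

  \<comment> \<open>Strongly convex \<open>h\<close> and strongly monotone \<open>F\<close>\<close>
  define D where "D = edom g"
  define G where "G u = real_of_ereal (g u)" for u
  define \<beta> where "\<beta> = \<theta> * \<alpha>B + \<sigma>B"
  define a where "a = \<theta> * \<alpha>A + \<sigma>A"
  define F where "F u = \<theta> *\<^sub>R B u + \<sigma>B *\<^sub>R u" for u
  define h where "h u = \<theta> * G u + \<sigma>A / 2 * (norm (u - 0))\<^sup>2 + (- (\<sigma>A + \<sigma>B) *\<^sub>R q) \<bullet> u" for u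
  have pos: "0 < \<beta>" "0 < a" "0 < \<sigma>A + \<sigma>B" using assms by (auto simp: \<beta>_def a_def)
  have G_sc: "modulus_convex_on \<alpha>A D G"
    unfolding D_def G_def by (rule alpha_convex_modulus_convex_on) fact+
  have h_sc: "modulus_convex_on a D h"
    unfolding a_def h_def
    by (intro modulus_convex_on_add_linear modulus_convex_on_add_quadratic modulus_convex_on_cmul G_sc)
      (use \<open>\<theta> > 0\<close> in simp)
  have h_cl: "closed (epigraph D h)"
    unfolding h_def G_def D_def
    by (intro closed_epigraph_add closed_epigraph_cmul lower_semicontinuous_closed_epigraph
        continuous_intros) fact+
  have D_ne: "D \<noteq> {}" using \<open>proper g\<close> by (simp add: proper_def D_def)
  have mono: "\<beta> * (norm (u - v))\<^sup>2 \<le> (u - v) \<bullet> (F u - F v)" for u v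
  proof -
    have "\<theta> * (\<alpha>B * (norm (u - v))\<^sup>2) \<le> \<theta> * ((u - v) \<bullet> (B u - B v))"
      using \<open>alpha_monotone \<alpha>B B\<close> \<open>\<theta> > 0\<close> by (intro mult_left_mono) (auto simp: alpha_monotone_def)
    moreover have "F u - F v = \<theta> *\<^sub>R (B u - B v) + \<sigma>B *\<^sub>R (u - v)"
      by (simp add: F_def algebra_simps)
    then have "(u - v) \<bullet> (F u - F v) = \<theta> * ((u - v) \<bullet> (B u - B v)) + \<sigma>B * (norm (u - v))\<^sup>2"
      by (simp only: inner_add_right inner_scaleR_right power2_norm_eq_inner)
    ultimately show ?thesis by (simp add: \<beta>_def distrib_right mult.assoc)
  qed
  obtain S :: "'a set" where "finite S" "span S = UNIV" using finite_dim by blast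
  then have ball: "compact (cball z r)" for z :: 'a and r by (rule compact_cball_finite_span)
  have lip: "\<exists>L. L-lipschitz_on (cball z r) F" for z r
  proof -
    obtain L where "L-lipschitz_on (cball z r) B"
      using locally_lipschitz_imp_lipschitz_on_compact[OF \<open>locally_lipschitz B\<close> ball] .
    then have "(\<bar>\<theta>\<bar> * L + \<bar>\<sigma>B\<bar> * 1)-lipschitz_on (cball z r) F"
      unfolding F_def by (intro lipschitz_on_add lipschitz_on_cmult lipschitz_on_id)
    then show ?thesis by blast
  qed
  have h_diff: "h y - h z = \<theta> * (G y - G z) + \<sigma>A * (z \<bullet> (y - z)) + \<sigma>A / 2 * (norm (y - z))\<^sup>2
       - (\<sigma>A + \<sigma>B) * (q \<bullet> (y - z))" for y z
    unfolding h_def power2_norm_eq_inner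
    by (simp add: inner_diff_left inner_diff_right inner_commute field_simps)
  obtain p where p: "p \<in> D" "\<And>y. y \<in> D \<Longrightarrow> h p \<le> h y + F p \<bullet> (y - p)"
    using strongly_monotone_vi_solution_exists[OF _ h_cl D_ne pos(1) mono lip]
      modulus_convex_on_mono[OF h_sc, of 0] pos by auto
  \<comment> \<open>\<open>p\<close> minimises \<open>h\<close> plus the linear function given by
    \<open>F p\<close>, so quadratic growth at a minimiser sharpens its variational
    inequality.\<close>
  have p_growth: "h p + a / 2 * (norm (y - p))\<^sup>2 \<le> h y + F p \<bullet> (y - p)" if "y \<in> D" for y
  proof -
    have "h p + F p \<bullet> p \<le> h y + F p \<bullet> y" if "y \<in> D" for y
      using p(2)[OF that] by (simp add: inner_diff_right)
    from modulus_convex_on_minimizer_growth[OF modulus_convex_on_add_linear[OF h_sc] p(1) this that]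
    show ?thesis by (simp add: inner_diff_right)
  qed

  \<comment> \<open>The resolvent as the solution set of the variational inequality\<close>
  define \<tau> where "\<tau> = \<theta> / (\<sigma>A + \<sigma>B)"
  define R where "R = resolvent \<tau> (\<lambda>z. (\<lambda>u. u + B z) ` frechet_subdifferential g z) q"
  have R_iff: "z \<in> R \<longleftrightarrow> z \<in> D \<and> (\<forall>y\<in>D. h z + a / 2 * (norm (y - z))\<^sup>2 \<le> h y + F z \<bullet> (y - z))" for z
  proof (cases "z \<in> D")
    case True
    have \<tau>: "0 < \<tau>" using pos \<open>\<theta> > 0\<close> by (simp add: \<tau>_def)
    \<comment> \<open>The only subgradient that can witness membership of \<open>z\<close> in the
      resolvent; its subgradient inequality times \<theta> is the inequality for \<open>h\<close>
      and \<open>F\<close>.\<close>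
    define w where "w = (1 / \<tau>) *\<^sub>R (q - z) - B z"
    have eq_w: "q = z + \<tau> *\<^sub>R (u + B z) \<longleftrightarrow> u = w" for u
    proof -
      have "\<tau> *\<^sub>R w = q - z - \<tau> *\<^sub>R B z" using \<tau> by (simp add: w_def scaleR_diff_right)
      then have "q = z + \<tau> *\<^sub>R (u + B z) \<longleftrightarrow> \<tau> *\<^sub>R u = \<tau> *\<^sub>R w" by (auto simp: algebra_simps)
      then show ?thesis using \<tau> by simp
    qed
    have "z \<in> R \<longleftrightarrow> (\<exists>u\<in>frechet_subdifferential g z. q = z + \<tau> *\<^sub>R (u + B z))"
      unfolding R_def resolvent_def by blast
    also have "\<dots> \<longleftrightarrow> w \<in> frechet_subdifferential g z" by (simp only: eq_w) blast
    also have "\<dots> \<longleftrightarrow> (\<forall>y\<in>D. G z + w \<bullet> (y - z) + \<alpha>A / 2 * (norm (y - z))\<^sup>2 \<le> G y)"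
      unfolding D_def G_def
      by (rule frechet_subdifferential_iff[OF \<open>proper g\<close> \<open>alpha_convex \<alpha>A g\<close> True[unfolded D_def]])
    also have "\<dots> \<longleftrightarrow> (\<forall>y\<in>D. h z + a / 2 * (norm (y - z))\<^sup>2 \<le> h y + F z \<bullet> (y - z))"
    proof (intro ball_cong refl)
      fix y
      have "\<theta> *\<^sub>R w = (\<sigma>A + \<sigma>B) *\<^sub>R (q - z) - \<theta> *\<^sub>R B z"
        using \<open>\<theta> > 0\<close> by (simp add: w_def \<tau>_def scaleR_diff_right)
      then have "\<theta> * (w \<bullet> (y - z)) = (\<sigma>A + \<sigma>B) * ((q - z) \<bullet> (y - z)) - \<theta> * (B z \<bullet> (y - z))"
        by (metis inner_diff_left inner_scaleR_left)
      then have "h y + F z \<bullet> (y - z) - (h z + a / 2 * (norm (y - z))\<^sup>2)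
          = \<theta> * (G y - (G z + w \<bullet> (y - z) + \<alpha>A / 2 * (norm (y - z))\<^sup>2))"
        using h_diff[of y z]
        by (simp add: F_def a_def inner_add_left inner_diff_left algebra_simps add_divide_distrib)
      then show "G z + w \<bullet> (y - z) + \<alpha>A / 2 * (norm (y - z))\<^sup>2 \<le> G y
          \<longleftrightarrow> h z + a / 2 * (norm (y - z))\<^sup>2 \<le> h y + F z \<bullet> (y - z)"
        using \<open>\<theta> > 0\<close> by (smt (verit) mult_nonneg_nonneg mult_pos_neg)
    qed
    finally show ?thesis using True by simp
  next
    case False
    then show ?thesis by (auto simp: R_def resolvent_def frechet_subdifferential_def D_def)
  qed
  have "p \<in> R" using R_iff p(1) p_growth by blast
  \<comment> \<open>Testing each of the two solutions with the other and adding contradicts strong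
    monotonicity unless they coincide.\<close>
  moreover have "z = p" if "z \<in> R" for z
  proof -
    have "z \<in> D" "h z + a / 2 * (norm (p - z))\<^sup>2 \<le> h p + F z \<bullet> (p - z)"
      using that R_iff p(1) by blast+
    moreover have "0 \<le> a / 2 * (norm (p - z))\<^sup>2" using pos by simp
    ultimately have "\<beta> * (norm (z - p))\<^sup>2 \<le> 0"
      using p(2)[of z] mono[of z p]
      by (simp add: inner_diff_left inner_diff_right inner_commute)
    then show ?thesis using pos by (simp add: mult_le_0_iff)
  qed
  ultimately have R_eq: "R = {p}" by blast

  \<comment> \<open>Step sizes over the natural numbers\<close>
  define l where "l k = \<gamma> (int k)" for k
  have F_diff: "\<theta> *\<^sub>R (B u - B v) + \<sigma>B *\<^sub>R (u - v) = F u - F v" for u v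
    by (simp add: F_def algebra_simps)
  have F_inj: "inj F" by (rule strongly_monotone_imp_inj[OF pos(1) mono])
  have l_step: "l (k + 2) =
       (if x (k + 2) = x (k + 1) then min ((1 / \<phi> + 1 / \<phi>\<^sup>2) * l (k + 1)) \<gamma>bar
        else min ((1 / \<phi> + 1 / \<phi>\<^sup>2) * l (k + 1))
          (min (\<phi>\<^sup>2 / (4 * l k) * ((norm (x (k + 2) - x (k + 1)))\<^sup>2 /
                 (norm (F (x (k + 2)) - F (x (k + 1))))\<^sup>2)) \<gamma>bar))" for k
    using stepsize[of "k + 2"] unfolding F_diff \<open>\<rho> = 1 / \<phi> + 1 / \<phi>\<^sup>2\<close>
    by (simp add: l_def add.commute)
  have "0 < \<phi>" using \<open>1 < \<phi>\<close> by simp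
  \<comment> \<open>The first step size refers to \<open>\<gamma> (-1)\<close>, outside the range of
    \<open>l\<close>, and is treated separately.\<close>
  have l1: "0 < l 1" "l 1 \<le> \<gamma>bar"
  proof -
    have "0 < \<rho> * \<gamma> 0" unfolding \<open>\<rho> = 1 / \<phi> + 1 / \<phi>\<^sup>2\<close>
      using \<open>0 < \<phi>\<close> \<open>\<gamma> 0 > 0\<close> by (intro mult_pos_pos add_pos_pos) auto
    moreover have "0 < \<gamma> (-1)" using \<open>\<gamma> (-1) = \<phi> * \<gamma> 0\<close> \<open>0 < \<phi>\<close> \<open>\<gamma> 0 > 0\<close> by simp
    moreover have "0 < norm (F (x 1) - F (x 0))" if "x 1 \<noteq> x 0"
      using injD[OF F_inj] that by auto
    ultimately show "0 < l 1" "l 1 \<le> \<gamma>bar"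
      using stepsize[of 1] \<open>0 < \<phi>\<close> \<open>\<gamma>bar > 0\<close> unfolding F_diff l_def
      by (auto intro!: mult_pos_pos divide_pos_pos)
  qed
  have l_pos: "0 < l k" for k
    by (rule graal_stepsize_pos[OF \<open>1 < \<phi>\<close> \<open>\<gamma>bar > 0\<close> _ l1(1) F_inj l_step])
      (use \<open>\<gamma> 0 > 0\<close> in \<open>simp add: l_def\<close>)

  \<comment> \<open>The proximal step as a variational inequality for \<open>h\<close>\<close>
  have upd: "x (k + 2) \<in> D \<and> (\<forall>y\<in>D. (xbar (k + 1) - l (k + 1) *\<^sub>R F (x (k + 1)) - x (k + 2)) \<bullet> (y - x (k + 2))
       \<le> l (k + 1) * (h y - h (x (k + 2))))" for k
  proof -
    define t where "t = l (k + 1)"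
    define e where "e = 1 + t * \<sigma>A"
    define c where "c = t * \<theta> / e"
    define n where "n = xbar (k + 1) - (t * \<sigma>B) *\<^sub>R x (k + 1) - (t * \<theta>) *\<^sub>R B (x (k + 1))
        + (t * (\<sigma>A + \<sigma>B)) *\<^sub>R q"
    have t: "0 < t" using l_pos by (simp add: t_def)
    have e: "0 < e" using t \<open>\<sigma>A > 0\<close> by (simp add: e_def add_pos_pos)
    have c: "0 < c" using t e \<open>\<theta> > 0\<close> by (simp add: c_def)
    have "\<alpha>A + 1 / c = (a + 1 / t) / \<theta>"
      using t e \<open>\<theta> > 0\<close> by (simp add: c_def a_def e_def field_simps)
    then have ac: "0 < \<alpha>A + 1 / c" using t pos \<open>\<theta> > 0\<close> by (simp add: add_pos_pos)
    obtain u where u: "prox c g ((1 / e) *\<^sub>R n) = {u}" "u \<in> edom g"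
      "\<And>y. y \<in> edom g \<Longrightarrow> ((1 / e) *\<^sub>R n - u) \<bullet> (y - u) + c * \<alpha>A / 2 * (norm (y - u))\<^sup>2
        \<le> c * (real_of_ereal (g y) - real_of_ereal (g u))"
      by (rule prox_singleton[OF \<open>proper g\<close> \<open>lower_semicontinuous g\<close> \<open>alpha_convex \<alpha>A g\<close> c ac]) blast
    have "x (k + 2) = the_elem (prox c g ((1 / e) *\<^sub>R n))"
      using update[of "k + 1"] by (simp add: l_def c_def e_def n_def t_def)
    then have xu: "x (k + 2) = u" using u(1) by simp
    have "(xbar (k + 1) - t *\<^sub>R F (x (k + 1)) - u) \<bullet> (y - u) \<le> t * (h y - h u)" if y: "y \<in> D" for y
    proof -
      \<comment> \<open>Multiplying by \<open>e\<close> undoes the scaling of the proximal argument.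
        The quadratic terms combine to \<open>t * a / 2 * (norm (y - u))\<^sup>2\<close>, which is
        nonnegative and is dropped.\<close>
      have "e * (((1 / e) *\<^sub>R n - u) \<bullet> (y - u) + c * \<alpha>A / 2 * (norm (y - u))\<^sup>2) \<le> e * (c * (G y - G u))"
        using u(3)[of y] y e by (intro mult_left_mono) (auto simp: D_def G_def)
      moreover have "e * (c * (G y - G u)) = t * \<theta> * (G y - G u)" using e by (simp add: c_def)
      moreover have "e * (((1 / e) *\<^sub>R n - u) \<bullet> (y - u) + c * \<alpha>A / 2 * (norm (y - u))\<^sup>2)
          = n \<bullet> (y - u) - e * (u \<bullet> (y - u)) + t * \<theta> * \<alpha>A / 2 * (norm (y - u))\<^sup>2"
        using e by (simp add: c_def inner_diff_left distrib_left right_diff_distrib)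
      moreover have "n \<bullet> (y - u) = (xbar (k + 1) - t *\<^sub>R F (x (k + 1))) \<bullet> (y - u)
          + t * (\<sigma>A + \<sigma>B) * (q \<bullet> (y - u))"
        by (simp add: n_def F_def inner_add_left inner_diff_left algebra_simps)
      moreover have "e * (u \<bullet> (y - u)) = u \<bullet> (y - u) + t * \<sigma>A * (u \<bullet> (y - u))"
        by (simp add: e_def distrib_right)
      moreover have "t * (h y - h u) = t * \<theta> * (G y - G u) + t * \<sigma>A * (u \<bullet> (y - u))
          + t * \<sigma>A / 2 * (norm (y - u))\<^sup>2 - t * (\<sigma>A + \<sigma>B) * (q \<bullet> (y - u))"
        unfolding h_diff by (simp add: right_diff_distrib distrib_left mult.assoc)
      moreover have "t * \<theta> * \<alpha>A / 2 * (norm (y - u))\<^sup>2 + t * \<sigma>A / 2 * (norm (y - u))\<^sup>2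
          = t * a / 2 * (norm (y - u))\<^sup>2"
        by (simp add: a_def field_simps)
      moreover have "0 \<le> t * a / 2 * (norm (y - u))\<^sup>2" using t pos by simp
      ultimately have "(xbar (k + 1) - t *\<^sub>R F (x (k + 1))) \<bullet> (y - u) - u \<bullet> (y - u) \<le> t * (h y - h u)"
        by linarith
      then show ?thesis by (simp only: inner_diff_left)
    qed
    then show ?thesis using u(2) xu by (simp add: t_def D_def)
  qed
  have avg: "\<phi> *\<^sub>R xbar (k + 1) = (\<phi> - 1) *\<^sub>R x (k + 1) + xbar k" for k
    using averaging[of "k + 1"] \<open>0 < \<phi>\<close> by simp
  \<comment> \<open>The golden ratio is the positive root of
    \<open>\<phi>\<^sup>2 = 1 + \<phi>\<close>; dividing by \<open>\<phi>\<^sup>2\<close> gives the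
    growth factor condition.\<close>
  have "\<phi>\<^sup>2 \<le> 1 + \<phi>"
  proof -
    have "(2 * \<phi> - 1)\<^sup>2 \<le> (sqrt 5)\<^sup>2"
      using \<open>1 < \<phi>\<close> \<open>\<phi> \<le> (1 + sqrt 5) / 2\<close> by (intro power_mono) auto
    then show ?thesis by (simp add: power2_eq_square algebra_simps)
  qed
  then have growth: "1 \<le> 1 / \<phi> + 1 / \<phi>\<^sup>2"
    using \<open>0 < \<phi>\<close> by (simp add: power2_eq_square field_simps)
  have "x \<longlonglongrightarrow> p" "xbar \<longlonglongrightarrow> p"
    using graal_converges[OF \<open>1 < \<phi>\<close> growth pos(1) \<open>\<gamma>bar > 0\<close> l_pos l1(2) mono lip p l_step avg] upd
    by blast+
  then show ?thesis using R_eq unfolding R_def \<tau>_def by blast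
qed

end
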